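(* Let $(h_k)_{k\ge0}$ be the sequence of complete homogeneous symmetric functions. The sequence $\mathcal{L}^i(h_k)$ is $s_\lambda$-nonnegative for $0\le i\le 3$. But the sequence $\mathcal{L}^4(h_k)$ is not $m_\lambda$-nonnegative.
   Context: Let $\Lambda(\mathbf{x})$ be the algebra of symmetric functions with real coefficients in countably many variables $\mathbf{x}=\{x_1,x_2,\ldots\}$ (formal power series of bounded degree, invariant under permutation of the variables). The function $h_k$ is the sum of all monomials of degree $k$ in the variables ($h_0=1$), and $h_k=0$ for $k<0$. For a partition $\lambda=(\lambda_1,\ldots,\lambda_\ell)$, $m_\lambda$ is the monomial symmetric function (the sum of all distinct monomials obtained from $x_1^{\lambda_1}\cdots x_\ell^{\lambda_\ell}$ by permuting variables), and $s_\lambda=\det(h_{\lambda_i-i+j})_{1\le i,j\le \ell}$ is the Schur function. Both $\{m_\lambda\}$ and $\{s_\lambda\}$, with $\lambda$ ranging over all partitions, are bases of $\Lambda(\mathbf{x})$. For a basis $\{b_\lambda\}$ of $\Lambda(\mathbf{x})$, an element $f\in\Lambda(\mathbf{x})$ is called $b_\lambda$-nonnegative if all coefficients in the expansion of $f$ in the basis $\{b_\lambda\}$ are $\ge0$. A sequence of symmetric functions is called $b_\lambda$-nonnegative if every one of its terms is $b_\lambda$-nonnegative. For a sequence $(a_k)_{k\ge0}$, with the convention $a_k=0$ for $k<0$, the operator $\mathcal{L}$ is defined by $\mathcal{L}(a_k)=(b_k)_{k\ge0}$ with $b_k=a_k^2-a_{k-1}a_{k+1}$. $\mathcal{L}^i$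 is its $i$-fold iterate, with $\mathcal{L}^0$ the identity. *)

theory Defs
  imports Complex_Main "HOL-Library.Poly_Mapping" "Jordan_Normal_Form.Determinant"
begin

section \<open>Monomials\<close>

text \<open>The monomial $\prod_i x_i^{\alpha_i}$ is represented by its exponent vector, so that
  addition of exponent vectors is multiplication of monomials.\<close>

type_synonym monomial = "nat \<Rightarrow>\<^sub>0 nat"

definition mon_degree :: "monomial \<Rightarrow> nat" where
  "mon_degree \<alpha> = (\<Sum>i\<in>Poly_Mapping.keys \<alpha>. Poly_Mapping.lookup \<alpha> i)"

definition mon_splits :: "monomial \<Rightarrow> (monomial \<times> monomial) set" where
  "mon_splits \<alpha> = {(\<beta>, \<gamma>). \<beta> + \<gamma> = \<alpha>}"

lemma mon_degree_superset:
  assumes "finite A" "Poly_Mapping.keys \<alpha> \<subseteq> A"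
  shows "mon_degree \<alpha> = (\<Sum>i\<in>A. Poly_Mapping.lookup \<alpha> i)"
  unfolding mon_degree_def
  by (rule sum.mono_neutral_left[OF assms]) (simp add: Poly_Mapping.in_keys_iff)

lemma mon_degree_add: "mon_degree (\<alpha> + \<beta>) = mon_degree \<alpha> + mon_degree \<beta>"
proof -
  let ?A = "Poly_Mapping.keys \<alpha> \<union> Poly_Mapping.keys \<beta>"
  have "Poly_Mapping.keys (\<alpha> + \<beta>) \<subseteq> ?A"
    by (rule Poly_Mapping.keys_add)
  then show ?thesis
    by (simp add: mon_degree_superset[of ?A] Poly_Mapping.lookup_add sum.distrib)
qed

lemma finite_mon_splits: "finite (mon_splits \<alpha>)"
proof -
  let ?F = "{f. \<forall>x. (x \<in> Poly_Mapping.keys \<alpha> \<longrightarrow> f x \<in> {..mon_degree \<alpha>}) \<and>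
                    (x \<notin> Poly_Mapping.keys \<alpha> \<longrightarrow> f x = (0::nat))}"
  have fin: "finite ?F"
    by (rule finite_set_of_finite_funs) auto
  have "(Poly_Mapping.lookup \<circ> fst) ` mon_splits \<alpha> \<subseteq> ?F"
  proof (rule image_subsetI)
    fix p assume "p \<in> mon_splits \<alpha>"
    then obtain \<beta> \<gamma> where p: "p = (\<beta>, \<gamma>)" and eq: "\<alpha> = \<beta> + \<gamma>"
      by (auto simp: mon_splits_def)
    have "Poly_Mapping.lookup \<beta> x \<le> mon_degree \<alpha>"
      if "x \<in> Poly_Mapping.keys \<alpha>" for x
    proof -
      have "Poly_Mapping.lookup \<beta> x \<le> Poly_Mapping.lookup \<alpha> x"
        by (simp add: eq Poly_Mapping.lookup_add)
      also have "\<dots> \<le> mon_degree \<alpha>"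
        unfolding mon_degree_def by (rule member_le_sum) (use that in auto)
      finally show ?thesis .
    qed
    moreover have "Poly_Mapping.lookup \<beta> x = 0" if "x \<notin> Poly_Mapping.keys \<alpha>" for x
      using that by (simp add: eq Poly_Mapping.in_keys_iff Poly_Mapping.lookup_add)
    ultimately show "(Poly_Mapping.lookup \<circ> fst) p \<in> ?F"
      by (simp add: p)
  qed
  then have "finite ((Poly_Mapping.lookup \<circ> fst) ` mon_splits \<alpha>)"
    using fin by (rule finite_subset)
  moreover have "inj_on (Poly_Mapping.lookup \<circ> fst) (mon_splits \<alpha>)"
    by (auto simp: inj_on_def mon_splits_def poly_mapping.lookup_inject)
  ultimately show ?thesis
    by (rule finite_imageD)
qed


section \<open>The algebra of symmetric functions\<close>

text \<open>A formal power series in $x_0, x_1, \ldots$ is given by its coefficients.  For a monomial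
  $\alpha$, the vector \<open>map_key \<pi> \<alpha>\<close> is $\alpha \circ \pi$.\<close>

definition symmetric_series :: "(monomial \<Rightarrow> real) \<Rightarrow> bool" where
  "symmetric_series f \<longleftrightarrow>
     (\<exists>d. \<forall>\<alpha>. f \<alpha> \<noteq> 0 \<longrightarrow> mon_degree \<alpha> \<le> d) \<and>
     (\<forall>\<pi>. bij \<pi> \<longrightarrow> (\<forall>\<alpha>. f (Poly_Mapping.map_key \<pi> \<alpha>) = f \<alpha>))"

typedef symfun = "{f. symmetric_series f}"
  morphisms coeff_of Abs_symfun
  by (rule exI[of _ "\<lambda>_. 0"]) (simp add: symmetric_series_def)

setup_lifting type_definition_symfun

lemma map_key_inv:
  fixes \<pi> :: "nat \<Rightarrow> nat" and \<alpha> :: monomial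
  assumes "bij \<pi>"
  shows "Poly_Mapping.map_key \<pi> (Poly_Mapping.map_key (inv_into UNIV \<pi>) \<alpha>) = \<alpha>"
        "Poly_Mapping.map_key (inv_into UNIV \<pi>) (Poly_Mapping.map_key \<pi> \<alpha>) = \<alpha>"
  using assms
  by (auto intro!: poly_mapping_eqI
      simp: Poly_Mapping.map_key.rep_eq bij_is_inj bij_imp_bij_inv bij_is_surj surj_f_inv_f)

lemma mon_degree_map_key:
  assumes "bij \<pi>"
  shows "mon_degree (Poly_Mapping.map_key \<pi> \<alpha>) = mon_degree \<alpha>"
  unfolding mon_degree_def
  by (rule sum.reindex_bij_witness[where i = "inv_into UNIV \<pi>" and j = \<pi>])
     (use assms in \<open>auto simp: Poly_Mapping.keys_map_key Poly_Mapping.map_key.rep_eq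
        bij_is_inj bij_is_surj surj_f_inv_f\<close>)

lemma map_key_zero_iff:
  fixes \<pi> :: "nat \<Rightarrow> nat" and \<alpha> :: monomial
  assumes "bij \<pi>"
  shows "Poly_Mapping.map_key \<pi> \<alpha> = 0 \<longleftrightarrow> \<alpha> = 0"
  using map_key_inv(2)[OF assms, of \<alpha>] by (metis Poly_Mapping.map_key_zero
    assms bij_imp_bij_inv bij_is_inj)

lemma symmetric_series_plus:
  assumes f: "symmetric_series f" and g: "symmetric_series g"
  shows "symmetric_series (\<lambda>\<alpha>. f \<alpha> + g \<alpha>)"
  unfolding symmetric_series_def
proof (intro conjI allI impI)
  from f obtain d where d: "\<And>\<alpha>. f \<alpha> \<noteq> 0 \<Longrightarrow> mon_degree \<alpha> \<le> d" by (auto simp: symmetric_series_def)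
  from g obtain e where e: "\<And>\<alpha>. g \<alpha> \<noteq> 0 \<Longrightarrow> mon_degree \<alpha> \<le> e" by (auto simp: symmetric_series_def)
  have "mon_degree \<alpha> \<le> d + e" if "f \<alpha> + g \<alpha> \<noteq> 0" for \<alpha>
    using d[of \<alpha>] e[of \<alpha>] that by (cases "f \<alpha> = 0") auto
  then show "\<exists>d. \<forall>\<alpha>. f \<alpha> + g \<alpha> \<noteq> 0 \<longrightarrow> mon_degree \<alpha> \<le> d" by blast
  fix \<pi> :: "nat \<Rightarrow> nat" and \<alpha> assume "bij \<pi>"
  then show "f (Poly_Mapping.map_key \<pi> \<alpha>) + g (Poly_Mapping.map_key \<pi> \<alpha>) = f \<alpha> + g \<alpha>"
    using f g by (simp add: symmetric_series_def)
qed

lemma symmetric_series_times: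
  assumes f: "symmetric_series f" and g: "symmetric_series g"
  shows "symmetric_series (\<lambda>\<alpha>. \<Sum>(\<beta>, \<gamma>)\<in>mon_splits \<alpha>. f \<beta> * g \<gamma>)"
  unfolding symmetric_series_def
proof (intro conjI allI impI)
  from f obtain d where d: "\<And>\<alpha>. f \<alpha> \<noteq> 0 \<Longrightarrow> mon_degree \<alpha> \<le> d" by (auto simp: symmetric_series_def)
  from g obtain e where e: "\<And>\<alpha>. g \<alpha> \<noteq> 0 \<Longrightarrow> mon_degree \<alpha> \<le> e" by (auto simp: symmetric_series_def)
  have "mon_degree \<alpha> \<le> d + e" if nz: "(\<Sum>(\<beta>, \<gamma>)\<in>mon_splits \<alpha>. f \<beta> * g \<gamma>) \<noteq> 0" for \<alpha>
  proof -
    obtain p where "p \<in> mon_splits \<alpha>" "(case p of (\<beta>, \<gamma>) \<Rightarrow> f \<beta> * g \<gamma>) \<noteq> 0"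
      by (rule sum.not_neutral_contains_not_neutral[OF nz])
    then show ?thesis
      by (auto simp: mon_splits_def mon_degree_add intro!: add_mono d e)
  qed
  then show "\<exists>d. \<forall>\<alpha>. (\<Sum>(\<beta>, \<gamma>)\<in>mon_splits \<alpha>. f \<beta> * g \<gamma>) \<noteq> 0 \<longrightarrow> mon_degree \<alpha> \<le> d"
    by blast
  fix \<pi> :: "nat \<Rightarrow> nat" and \<alpha> assume \<pi>: "bij \<pi>"
  have inj: "inj \<pi>" "inj (inv_into UNIV \<pi>)"
    using \<pi> by (auto simp: bij_is_inj bij_imp_bij_inv)
  let ?m = "Poly_Mapping.map_key \<pi>" and ?m' = "Poly_Mapping.map_key (inv_into UNIV \<pi>)"
  have fs: "f (?m \<beta>) = f \<beta>" "f (?m' \<beta>) = f \<beta>" "g (?m \<beta>) = g \<beta>" "g (?m' \<beta>) = g \<beta>" for \<beta>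
    using f g \<pi> bij_imp_bij_inv[OF \<pi>] by (auto simp: symmetric_series_def)
  show "(\<Sum>(\<beta>, \<gamma>)\<in>mon_splits (?m \<alpha>). f \<beta> * g \<gamma>) = (\<Sum>(\<beta>, \<gamma>)\<in>mon_splits \<alpha>. f \<beta> * g \<gamma>)"
    by (rule sum.reindex_bij_witness
        [where i = "map_prod ?m ?m" and j = "map_prod ?m' ?m'"])
       (auto simp: mon_splits_def map_key_inv[OF \<pi>] fs
          simp flip: Poly_Mapping.map_key_plus[OF inj(1)] Poly_Mapping.map_key_plus[OF inj(2)])
qed

instantiation symfun :: "{comm_ring_1, real_algebra_1}"
begin

lift_definition zero_symfun :: symfun is "\<lambda>_. 0"
  by (simp add: symmetric_series_def)

lift_definition one_symfun :: symfun is "\<lambda>\<alpha>. if \<alpha> = 0 then 1 else 0"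
  by (auto simp: symmetric_series_def map_key_zero_iff mon_degree_def)

lift_definition plus_symfun :: "symfun \<Rightarrow> symfun \<Rightarrow> symfun" is "\<lambda>f g \<alpha>. f \<alpha> + g \<alpha>"
  by (rule symmetric_series_plus)

lift_definition uminus_symfun :: "symfun \<Rightarrow> symfun" is "\<lambda>f \<alpha>. - f \<alpha>"
  by (simp add: symmetric_series_def)

definition minus_symfun :: "symfun \<Rightarrow> symfun \<Rightarrow> symfun" where
  "minus_symfun f g = f + - g"

lift_definition scaleR_symfun :: "real \<Rightarrow> symfun \<Rightarrow> symfun" is "\<lambda>r f \<alpha>. r * f \<alpha>"
  by (auto simp: symmetric_series_def)

lift_definition times_symfun :: "symfun \<Rightarrow> symfun \<Rightarrow> symfun" is
  "\<lambda>f g \<alpha>. \<Sum>(\<beta>, \<gamma>)\<in>mon_splits \<alpha>. f \<beta> * g \<gamma>"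
  by (rule symmetric_series_times)

instance
proof
  fix f g h :: symfun and r s :: real
  show "f + g + h = f + (g + h)" by transfer (simp add: add.assoc)
  show "f + g = g + f" by transfer (simp add: add.commute)
  show "0 + f = f" by transfer simp
  show "- f + f = 0" by transfer simp
  show "f - g = f + - g" by (rule minus_symfun_def)
  show "(0::symfun) \<noteq> 1" by transfer (auto simp: fun_eq_iff)
  show "r *\<^sub>R (f + g) = r *\<^sub>R f + r *\<^sub>R g" by transfer (simp add: algebra_simps)
  show "(r + s) *\<^sub>R f = r *\<^sub>R f + s *\<^sub>R f" by transfer (simp add: algebra_simps)
  show "r *\<^sub>R s *\<^sub>R f = (r * s) *\<^sub>R f" by transfer (simp add: algebra_simps)
  show "1 *\<^sub>R f = f" by transfer simp
  show "r *\<^sub>R f * g = r *\<^sub>R (f * g)"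
    by transfer (simp add: sum_distrib_left case_prod_unfold mult.assoc)
  show "f * r *\<^sub>R g = r *\<^sub>R (f * g)"
    by transfer (simp add: sum_distrib_left case_prod_unfold mult.left_commute)
  have distrib: "(f + g) * h = f * h + g * h" for f g h :: symfun
    by transfer (simp add: sum.distrib case_prod_unfold distrib_right)
  have comm: "f * g = g * f" for f g :: symfun
  proof (transfer, rule ext)
    fix f g :: "monomial \<Rightarrow> real" and \<alpha>
    show "(\<Sum>(\<beta>, \<gamma>)\<in>mon_splits \<alpha>. f \<beta> * g \<gamma>) = (\<Sum>(\<beta>, \<gamma>)\<in>mon_splits \<alpha>. g \<beta> * f \<gamma>)"
      by (rule sum.reindex_bij_witness[where i = prod.swap and j = prod.swap])
         (auto simp: mon_splits_def add.commute mult.commute)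
  qed
  have one: "1 * f = f" for f :: symfun
  proof (transfer, rule ext)
    fix f :: "monomial \<Rightarrow> real" and \<alpha>
    have "(\<Sum>(\<beta>, \<gamma>)\<in>mon_splits \<alpha>. (if \<beta> = 0 then 1 else 0) * f \<gamma>) =
        (\<Sum>(\<beta>, \<gamma>)\<in>{(0 :: monomial, \<alpha>)}. (if \<beta> = 0 then 1 else 0) * f \<gamma>)"
      by (rule sum.mono_neutral_right[OF finite_mon_splits]) (auto simp: mon_splits_def split: if_splits)
    then show "(\<Sum>(\<beta>, \<gamma>)\<in>mon_splits \<alpha>. (if \<beta> = 0 then 1 else 0) * f \<gamma>) = f \<alpha>"
      by simp
  qed
  show "f * g = g * f" by (rule comm)
  show "(f + g) * h = f * h + g * h" "f * (g + h) = f * g + f * h"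
    by (simp_all add: distrib comm[of f])
  show "1 * f = f" "f * 1 = f"
    by (simp_all add: one comm[of f])
  show "f * g * h = f * (g * h)"
  proof (transfer, rule ext)
    fix f g h :: "monomial \<Rightarrow> real" and \<alpha>
    have "(\<Sum>(\<delta>, \<gamma>)\<in>mon_splits \<alpha>. (\<Sum>(\<beta>, \<beta>')\<in>mon_splits \<delta>. f \<beta> * g \<beta>') * h \<gamma>) =
        (\<Sum>(p, q)\<in>(SIGMA p:mon_splits \<alpha>. mon_splits (fst p)). f (fst q) * g (snd q) * h (snd p))"
      by (simp add: sum.Sigma finite_mon_splits case_prod_unfold sum_distrib_right)
    also have "\<dots> = (\<Sum>(p, q)\<in>(SIGMA p:mon_splits \<alpha>. mon_splits (snd p)).
        f (fst p) * (g (fst q) * h (snd q)))"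
      by (rule sum.reindex_bij_witness
          [where j = "\<lambda>(p, q). ((fst q, snd q + snd p), (snd q, snd p))"
             and i = "\<lambda>(p, q). ((fst p + fst q, snd q), (fst p, fst q))"])
         (auto simp: mon_splits_def add.assoc mult.assoc)
    also have "\<dots> = (\<Sum>(\<beta>, \<delta>)\<in>mon_splits \<alpha>. f \<beta> * (\<Sum>(\<beta>', \<gamma>)\<in>mon_splits \<delta>. g \<beta>' * h \<gamma>))"
      by (simp add: sum.Sigma finite_mon_splits case_prod_unfold sum_distrib_left)
    finally show "(\<Sum>(\<delta>, \<gamma>)\<in>mon_splits \<alpha>. (\<Sum>(\<beta>, \<beta>')\<in>mon_splits \<delta>. f \<beta> * g \<beta>') * h \<gamma>) =
        (\<Sum>(\<beta>, \<delta>)\<in>mon_splits \<alpha>. f \<beta> * (\<Sum>(\<beta>', \<gamma>)\<in>mon_splits \<delta>. g \<beta>' * h \<gamma>))" .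
  qed
qed

end


section \<open>Complete homogeneous, monomial and Schur functions\<close>

lift_definition complete_h :: "nat \<Rightarrow> symfun" is
  "\<lambda>k \<alpha>. if mon_degree \<alpha> = k then 1 else 0"
  by (auto simp: symmetric_series_def mon_degree_map_key)

definition complete_h_int :: "int \<Rightarrow> symfun" where
  "complete_h_int k = (if k < 0 then 0 else complete_h (nat k))"

definition partitions :: "nat list set" where
  "partitions = {\<mu>. sorted_wrt (\<ge>) \<mu> \<and> 0 \<notin> set \<mu>}"

text \<open>\<open>Poly_Mapping.nth \<mu>\<close> is the exponent vector of
  $x_0^{\mu_0} \cdots x_{\ell-1}^{\mu_{\ell-1}}$.\<close>

lift_definition monomial_sf :: "nat list \<Rightarrow> symfun" is
  "\<lambda>\<mu> \<alpha>. if \<exists>\<pi>. bij \<pi> \<and> \<alpha> = Poly_Mapping.map_key \<pi> (Poly_Mapping.nth \<mu>) then 1 else 0"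
proof (unfold symmetric_series_def, intro conjI allI impI)
  fix \<mu> :: "nat list"
  show "\<exists>d. \<forall>\<alpha>. (if \<exists>\<pi>. bij \<pi> \<and> \<alpha> = Poly_Mapping.map_key \<pi> (Poly_Mapping.nth \<mu>)
      then 1 else 0 :: real) \<noteq> 0 \<longrightarrow> mon_degree \<alpha> \<le> d"
    by (rule exI[of _ "mon_degree (Poly_Mapping.nth \<mu>)"]) (auto simp: mon_degree_map_key)
  fix \<sigma> :: "nat \<Rightarrow> nat" and \<alpha> assume \<sigma>: "bij \<sigma>"
  have "(\<exists>\<pi>. bij \<pi> \<and> Poly_Mapping.map_key \<sigma> \<alpha> = Poly_Mapping.map_key \<pi> (Poly_Mapping.nth \<mu>)) \<longleftrightarrow>
      (\<exists>\<pi>. bij \<pi> \<and> \<alpha> = Poly_Mapping.map_key \<pi> (Poly_Mapping.nth \<mu>))" (is "?L \<longleftrightarrow> ?R")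
  proof
    assume ?L
    then obtain \<pi> where \<pi>: "bij \<pi>"
      "Poly_Mapping.map_key \<sigma> \<alpha> = Poly_Mapping.map_key \<pi> (Poly_Mapping.nth \<mu>)" by blast
    have "\<alpha> = Poly_Mapping.map_key (inv_into UNIV \<sigma>) (Poly_Mapping.map_key \<pi> (Poly_Mapping.nth \<mu>))"
      using \<pi>(2) map_key_inv(2)[OF \<sigma>, of \<alpha>] by simp
    also have "\<dots> = Poly_Mapping.map_key (\<pi> \<circ> inv_into UNIV \<sigma>) (Poly_Mapping.nth \<mu>)"
      using \<sigma> \<pi>(1) by (intro Poly_Mapping.map_key_compose) (auto simp: bij_is_inj bij_imp_bij_inv)
    finally show ?R using \<sigma> \<pi>(1) bij_comp bij_imp_bij_inv by blast
  next
    assume ?R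
    then obtain \<pi> where \<pi>: "bij \<pi>" "\<alpha> = Poly_Mapping.map_key \<pi> (Poly_Mapping.nth \<mu>)" by blast
    have "Poly_Mapping.map_key \<sigma> \<alpha> = Poly_Mapping.map_key (\<pi> \<circ> \<sigma>) (Poly_Mapping.nth \<mu>)"
      unfolding \<pi>(2)
      using \<sigma> \<pi>(1) by (intro Poly_Mapping.map_key_compose) (auto simp: bij_is_inj)
    then show ?L using \<sigma> \<pi>(1) bij_comp by blast
  qed
  then show "(if \<exists>\<pi>. bij \<pi> \<and> Poly_Mapping.map_key \<sigma> \<alpha> = Poly_Mapping.map_key \<pi> (Poly_Mapping.nth \<mu>)
      then 1 else 0 :: real) =
    (if \<exists>\<pi>. bij \<pi> \<and> \<alpha> = Poly_Mapping.map_key \<pi> (Poly_Mapping.nth \<mu>) then 1 else 0)"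
    by simp
qed

definition schur :: "nat list \<Rightarrow> symfun" where
  "schur \<mu> = det (mat (length \<mu>) (length \<mu>)
     (\<lambda>(i, j). complete_h_int (int (\<mu> ! i) - int i + int j)))"


section \<open>Nonnegativity with respect to a basis\<close>

definition is_expansion ::
    "(nat list \<Rightarrow> symfun) \<Rightarrow> (nat list \<Rightarrow>\<^sub>0 real) \<Rightarrow> symfun \<Rightarrow> bool" where
  "is_expansion b c f \<longleftrightarrow> Poly_Mapping.keys c \<subseteq> partitions \<and>
     f = (\<Sum>\<mu>\<in>Poly_Mapping.keys c. Poly_Mapping.lookup c \<mu> *\<^sub>R b \<mu>)"

text \<open>This is meant for families \<open>b\<close> whose members \<open>b \<mu>\<close>, for \<open>\<mu> \<in> partitions\<close>, form a basis
  (such as \<open>monomial_sf\<close> and \<open>schur\<close>), so that the expansion \<open>c\<close> of \<open>f\<close> exists and is unique.\<close>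

definition nonneg_wrt :: "(nat list \<Rightarrow> symfun) \<Rightarrow> symfun \<Rightarrow> bool" where
  "nonneg_wrt b f \<longleftrightarrow>
     (\<exists>c. is_expansion b c f \<and> (\<forall>\<mu>\<in>partitions. 0 \<le> Poly_Mapping.lookup c \<mu>))"

definition seq_nonneg_wrt :: "(nat list \<Rightarrow> symfun) \<Rightarrow> (nat \<Rightarrow> symfun) \<Rightarrow> bool" where
  "seq_nonneg_wrt b a \<longleftrightarrow> (\<forall>k. nonneg_wrt b (a k))"


section \<open>The log-concavity operator\<close>

definition logconc :: "(nat \<Rightarrow> 'a::comm_ring_1) \<Rightarrow> nat \<Rightarrow> 'a" where
  "logconc a k = (a k)\<^sup>2 - (if k = 0 then 0 else a (k - 1)) * a (k + 1)"

end

theory Submission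
  imports Defs "HOL-Computational_Algebra.Formal_Power_Series"
begin

text \<open>Write $T_n(k) = \det (h_{k-i+j})_{1 \le i,j \le n}$ for the Schur function of the $n \times k$
  rectangle.  Dodgson condensation $T_n(k)^2 - T_n(k-1) T_n(k+1) = T_{n+1}(k) T_{n-1}(k)$ gives
  $\mathcal L(h_k) = T_2(k)$, $\mathcal L^2(h_k) = T_3(k) h_k$ and
  $\mathcal L^3(h_k) = T_4(k) T_2(k) h_k^2 + T_3(k-1) T_3(k+1) T_2(k)$, so it suffices that products of
  Schur functions are Schur nonnegative.  This is the Littlewood--Richardson rule, proved by expanding
  one factor as a Jacobi--Trudi determinant, applying the Pieri rule repeatedly, and cancelling with
  the sign-reversing involution of Gasharov and Stembridge.  For the second claim, substitute
  $(1, 1, x_2, x_3, 0, \ldots)$ into the term of $\mathcal L^4(h_k)$ with $k = 2$: the coefficient of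
  $x_2^7 x_3$ is $-3$, and it is a sum of coefficients of monomial symmetric functions.\<close>

section \<open>Jacobi--Trudi determinants\<close>

text \<open>The obstacle is an off-by-one: transposing two neighbouring columns in a Jacobi-Trudi
  term turns the indices (p, q) into (q - 1, p + 1), whereas a plain Bender-Knuth reflection turns
  the strip sizes (p, q) into (q, p). The gap is closed at a column where the content, accumulated
  from the right, stops being weakly decreasing. There the defect is exactly one, and reflecting
  only the columns to the left produces the required shift. Cutting at that column is harmless
  because it contains no cell of the smaller of the two letters. Tableaux are stored as chains of
  partitions, so that contents become differences of \<open>excess\<close> and the cut becomes a
  truncation of row lengths. Since strips may add rows, all determinants in a product have a common
  size, with zero parts as padding. In the second claim, the chosen term still has nonnegative
  coefficients at x_3 = 0; the negative one appears at first order in x_3.\<close>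

abbreviation H :: "int \<Rightarrow> symfun" where "H \<equiv> complete_h_int"

lemma H_neg [simp]: "k < 0 \<Longrightarrow> H k = 0"
  by (simp add: complete_h_int_def)

lemma complete_h_0 [simp]: "complete_h 0 = 1"
  by transfer (auto simp: mon_degree_def fun_eq_iff Poly_Mapping.in_keys_iff intro!: poly_mapping_eqI)

lemma H_0 [simp]: "H 0 = 1"
  by (simp add: complete_h_int_def)

text \<open>The size is an explicit parameter and parts are padded with zeros, so that partitions of
  different lengths fit into one sum of determinants of equal size.\<close>

definition jt :: "nat \<Rightarrow> (nat \<Rightarrow> nat) \<Rightarrow> symfun" where
  "jt M f = det (mat M M (\<lambda>(i, j). H (int (f i) - int i + int j)))"

lemma schur_eq_jt: "schur \<mu> = jt (length \<mu>) (nth \<mu>)"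
  by (simp add: schur_def jt_def)

lemma jt_cong: "(\<And>i. i < M \<Longrightarrow> f i = g i) \<Longrightarrow> jt M f = jt M g"
  unfolding jt_def by (intro arg_cong[where f = det] eq_matI) auto

lemma det_row_zero:
  fixes A :: "'a::comm_ring_1 mat"
  assumes "A \<in> carrier_mat n n" "i < n" "\<And>j. j < n \<Longrightarrow> A $$ (i, j) = 0"
  shows "det A = 0"
  using assms by (simp add: laplace_expansion_row)

lemma det_last_row:
  fixes A :: "'a::comm_ring_1 mat"
  assumes A: "A \<in> carrier_mat (Suc n) (Suc n)" and 0: "\<And>j. j < n \<Longrightarrow> A $$ (n, j) = 0"
  shows "det A = A $$ (n, n) * det (mat n n (\<lambda>(i, j). A $$ (i, j)))"
proof -
  have "det A = (\<Sum>j<Suc n. A $$ (n, j) * cofactor A n j)"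
    by (rule laplace_expansion_row[OF A]) simp
  also have "\<dots> = A $$ (n, n) * cofactor A n n"
    using 0 by simp
  also have "mat_delete A n n = mat n n (\<lambda>(i, j). A $$ (i, j))"
    using A by (intro eq_matI) (auto simp: mat_delete_def)
  hence "cofactor A n n = det (mat n n (\<lambda>(i, j). A $$ (i, j)))"
    by (simp add: cofactor_def)
  finally show ?thesis .
qed

lemma jt_Suc:
  assumes "f M = 0"
  shows "jt (Suc M) f = jt M f"
proof -
  let ?A = "mat (Suc M) (Suc M) (\<lambda>(i, j). H (int (f i) - int i + int j))"
  have "det ?A = ?A $$ (M, M) * det (mat M M (\<lambda>(i, j). ?A $$ (i, j)))"
    by (rule det_last_row) (use assms in auto)
  also have "mat M M (\<lambda>(i, j). ?A $$ (i, j)) = mat M M (\<lambda>(i, j). H (int (f i) - int i + int j))"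
    by (intro eq_matI) auto
  finally show ?thesis using assms by (simp add: jt_def)
qed

lemma jt_extend:
  assumes "\<And>i. M \<le> i \<Longrightarrow> f i = 0"
  shows "jt (M + k) f = jt M f"
  using assms by (induction k) (simp_all add: jt_Suc)

text \<open>Members of \<open>partitions\<close> have no zero parts, so trailing zero rows are
  peeled off by \<open>jt_Suc\<close> until the last part is positive; monotonicity then makes every
  part positive.\<close>

lemma jt_schur:
  assumes "antimono f" "\<And>i. M \<le> i \<Longrightarrow> f i = 0"
  shows "\<exists>\<mu>\<in>partitions. jt M f = schur \<mu>"
  using assms(2)
proof (induction M)
  case 0
  show ?case
    by (rule bexI[of _ "[]"]) (auto simp: schur_eq_jt partitions_def intro: jt_cong)
next
  case (Suc M)
  show ?case
  proof (cases "f M = 0")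
    case True
    hence "f i = 0" if "M \<le> i" for i
      using Suc.prems[of i] that by (cases "i = M") auto
    with Suc.IH True show ?thesis
      by (simp add: jt_Suc)
  next
    case False
    have pos: "0 < f i" if "i \<le> M" for i
      using False antimonoD[OF assms(1) that] by simp
    show ?thesis
    proof (rule bexI)
      have "sorted_wrt (\<ge>) (map f [0..<Suc M])"
        using antimonoD[OF assms(1)] unfolding sorted_wrt_iff_nth_less
        by (simp del: upt_Suc)
      moreover have "f i \<noteq> 0" if "i < Suc M" for i
        using pos[of i] that by simp
      hence "0 \<notin> set (map f [0..<Suc M])"
        unfolding set_map set_upt by (metis atLeastLessThan_iff imageE)
      ultimately show "map f [0..<Suc M] \<in> partitions"
        by (simp add: partitions_def del: upt_Suc)
      show "jt (Suc M) f = schur (map f [0..<Suc M])"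
        unfolding schur_eq_jt by (simp del: upt_Suc) (rule jt_cong, simp del: upt_Suc)
    qed
  qed
qed

section \<open>The Pieri rule\<close>

text \<open>Horizontal strips in interlacing form: the second inequality says that the skew shape g
  / f has no two cells in one column.\<close>

definition hstrip :: "(nat \<Rightarrow> nat) \<Rightarrow> (nat \<Rightarrow> nat) \<Rightarrow> bool" where
  "hstrip f g \<longleftrightarrow> (\<forall>i. f i \<le> g i \<and> g (Suc i) \<le> f i)"

lemma permutes_lessI: "p permutes {0..<M::nat} \<Longrightarrow> i < M \<Longrightarrow> p i < M"
  using permutes_in_image[of p "{0..<M}" i] by simp

text \<open>Each term of the determinant takes one entry per row, so its coefficient distributes the
  degree r over the rows. The distributions, stored as multisets of row indices, do not depend on
  the permutation, and the two sums can be exchanged.\<close>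

lemma fps_nth_det:
  fixes A :: "nat \<times> nat \<Rightarrow> 'a::comm_ring_1 fps"
  shows "fps_nth (det (mat M M A)) r =
    (\<Sum>X\<in>multisets_of_size {0..<M} r. det (mat M M (\<lambda>(i, j). fps_nth (A (i, j)) (count X i))))"
proof -
  have sg: "fps_nth (signof p * F) r = signof p * fps_nth F r" for p :: "nat \<Rightarrow> nat" and F :: "'a fps"
    by (simp add: sign_def)
  have det: "det (mat M M B) = (\<Sum>p | p permutes {0..<M}. signof p * (\<Prod>i=0..<M. B (i, p i)))"
    for B :: "nat \<times> nat \<Rightarrow> 'b::comm_ring_1"
    unfolding det_def'[OF mat_carrier]
    by (intro sum.cong prod.cong refl arg_cong2[where f = "(*)"]) (simp add: permutes_lessI)
  have "fps_nth (det (mat M M A)) r = (\<Sum>p | p permutes {0..<M}. signof p *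
      (\<Sum>X\<in>multisets_of_size {0..<M} r. \<Prod>i=0..<M. fps_nth (A (i, p i)) (count X i)))"
    by (simp only: det fps_sum_nth sg fps_prod_nth' finite_atLeastLessThan)
  also have "\<dots> = (\<Sum>X\<in>multisets_of_size {0..<M} r.
      \<Sum>p | p permutes {0..<M}. signof p * (\<Prod>i=0..<M. fps_nth (A (i, p i)) (count X i)))"
    by (subst sum.swap) (simp only: sum_distrib_left)
  also have "\<dots> = (\<Sum>X\<in>multisets_of_size {0..<M} r. det (mat M M (\<lambda>(i, j). fps_nth (A (i, j)) (count X i))))"
    by (simp only: det case_prod_conv)
  finally show ?thesis .
qed

lemma fps_const_comm_ring_hom: "comm_ring_hom (fps_const :: 'a::comm_ring_1 \<Rightarrow> 'a fps)"
  by unfold_locales (auto simp flip: fps_const_add fps_const_mult)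

text \<open>The matrix \<open>E\<close> below has the untruncated series $\sum_b X^b h_{f_i + b - i + j}$ as entries.
  Subtracting multiples of each row from the next truncates these to horizontal strips, while
  subtracting \<open>X\<close> times each column from the previous one leaves the original matrix except in the last
  column.\<close>

lemma det_pieri:
  assumes zero: "f m = 0" and anti: "antimono f"
  shows "det (mat (Suc m) (Suc m) (\<lambda>(i, j). Abs_fps (\<lambda>b.
      if 0 < i \<and> f (i - 1) < f i + b then 0 else H (int (f i + b) - int i + int j)))) =
    Abs_fps (\<lambda>b. H (int b)) * fps_const (jt (Suc m) f)" (is "det ?R = _")
proof -
  let ?M = "Suc m"
  define e :: "nat \<Rightarrow> nat \<Rightarrow> symfun fps"
    where "e i j = Abs_fps (\<lambda>b. H (int (f i + b) - int i + int j))" for i j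
  define E where "E = mat ?M ?M (\<lambda>(i, j). e i j)"
  define L where "L = mat ?M ?M (\<lambda>(i, k). if k = i then 1
      else if Suc k = i then - (fps_X ^ Suc (f k - f i)) else 0 :: symfun fps)"
  define U where "U = mat ?M ?M (\<lambda>(k, j). if k = j then 1
      else if k = Suc j then - fps_X else 0 :: symfun fps)"
  have carrier: "E \<in> carrier_mat ?M ?M" "L \<in> carrier_mat ?M ?M" "U \<in> carrier_mat ?M ?M"
    by (simp_all add: E_def L_def U_def)
  have "L * E = ?R"
  proof (rule eq_matI, goal_cases)
    case (1 i j)
    hence ij: "i < ?M" "j < ?M" by auto
    have "(L * E) $$ (i, j) = (\<Sum>k<?M. (if k = i then e k j else 0) +
        (if Suc k = i then - (fps_X ^ Suc (f k - f i)) * e k j else 0))"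
      using ij by (auto simp: L_def E_def scalar_prod_def lessThan_atLeast0 intro!: sum.cong)
    also have "\<dots> = e i j + (\<Sum>k<?M. if Suc k = i then - (fps_X ^ Suc (f k - f i)) * e k j else 0)"
      using ij by (simp add: sum.distrib)
    also have "\<dots> = ?R $$ (i, j)"
    proof (cases i)
      case 0
      thus ?thesis using ij by (simp add: e_def)
    next
      case (Suc k)
      have le: "f (Suc k) \<le> f k" using antimonoD[OF anti, of k "Suc k"] by simp
      have eq: "(\<Sum>k'<?M. if Suc k' = i then - (fps_X ^ Suc (f k' - f i)) * e k' j else 0) =
          - (fps_X ^ Suc (f k - f i)) * e k j"
        using ij Suc by simp
      \<comment> \<open>With \<open>i = Suc k\<close>, the shifted row k agrees with row i in all
        coefficients b > f k - f i and vanishes below, so row i is cut off exactly where the strip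
        condition fails.\<close>
      show ?thesis
        unfolding eq using ij le Suc
        by (intro fps_ext)
          (auto simp: e_def fps_X_power_mult_nth not_less_eq algebra_simps simp del: power_Suc)
    qed
    finally show ?case .
  qed (simp_all add: L_def E_def)
  moreover have "det L = 1"
    by (subst det_lower_triangular[OF _ carrier(2)])
       (auto simp: L_def prod_list_diag_prod intro!: prod.neutral)
  ultimately have R: "det ?R = det E"
    using det_mult[OF carrier(2,1)] by simp
  have EU: "(E * U) $$ (i, j) = (if j = m then e i j else fps_const (H (int (f i) - int i + int j)))"
    if ij: "i < ?M" "j < ?M" for i j
  proof -
    have "(E * U) $$ (i, j) = (\<Sum>k<?M. (if k = j then e i k else 0) +
        (if k = Suc j then - fps_X * e i k else 0))"
      using ij by (auto simp: U_def E_def scalar_prod_def lessThan_atLeast0 intro!: sum.cong)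
    also have "\<dots> = e i j + (if j = m then 0 else - fps_X * e i (Suc j))"
      using ij by (simp add: sum.distrib)
    also have "\<dots> = (if j = m then e i j else fps_const (H (int (f i) - int i + int j)))"
      by (auto intro!: fps_ext simp: e_def algebra_simps of_nat_diff)
    finally show ?thesis .
  qed
  have "det U = 1"
    by (subst det_lower_triangular[OF _ carrier(3)])
       (auto simp: U_def prod_list_diag_prod intro!: prod.neutral)
  hence "det E = det (E * U)"
    using det_mult[OF carrier(1,3)] by simp
  also have "\<dots> = (E * U) $$ (m, m) * det (mat m m (\<lambda>(i, j). (E * U) $$ (i, j)))"
  proof (rule det_last_row)
    \<comment> \<open>The last part is zero, so this row holds only \<open>H\<close> of negative
      index before the corner; the corner is the generating series of the complete functions and
      splits off.\<close>
    show "(E * U) $$ (m, j) = 0" if "j < m" for j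
      using that by (subst EU) (simp_all add: zero)
  qed (use carrier in auto)
  also have "(E * U) $$ (m, m) = Abs_fps (\<lambda>b. H (int b))"
    by (simp add: EU e_def zero)
  also have "mat m m (\<lambda>(i, j). (E * U) $$ (i, j)) =
      map_mat fps_const (mat m m (\<lambda>(i, j). H (int (f i) - int i + int j)))"
    by (intro eq_matI) (auto simp: EU)
  also have "det \<dots> = fps_const (jt m f)"
    by (simp add: jt_def comm_ring_hom.hom_det[OF fps_const_comm_ring_hom])
  finally show ?thesis
    using R zero by (simp add: jt_Suc)
qed

text \<open>This is the coefficient of \<open>X^r\<close> in \<open>det_pieri\<close>. Row i
  contributes some degree b_i, which turns f into f + b; if that is not a horizontal strip over f, a
  row vanishes and the term drops out.\<close>

lemma pieri:
  assumes zero: "\<And>i. m \<le> i \<Longrightarrow> f i = 0" and anti: "antimono f"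
  shows "H (int r) * jt (Suc m) f =
    (\<Sum>g | hstrip f g \<and> sum g {..<Suc m} = sum f {..<Suc m} + r. jt (Suc m) g)"
    (is "_ = sum _ ?G")
proof -
  let ?M = "Suc m"
  let ?A = "\<lambda>(i, j). Abs_fps (\<lambda>b.
      if 0 < i \<and> f (i - 1) < f i + b then 0 else H (int (f i + b) - int i + int j))"
  let ?B = "\<lambda>X. mat ?M ?M (\<lambda>(i, j). fps_nth (?A (i, j)) (count X i))"
  let ?S = "{X \<in> multisets_of_size {0..<?M} r. hstrip f (\<lambda>i. f i + count X i)}"
  have "H (int r) * jt ?M f = fps_nth (det (mat ?M ?M ?A)) r"
    using det_pieri[OF zero anti, of m] by simp
  also have "\<dots> = (\<Sum>X\<in>multisets_of_size {0..<?M} r. det (?B X))"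
    by (rule fps_nth_det)
  also have "\<dots> = (\<Sum>X\<in>?S. det (?B X))"
  proof (rule sum.mono_neutral_right)
    show "\<forall>X\<in>multisets_of_size {0..<?M} r - ?S. det (?B X) = 0"
    proof
      fix X assume X: "X \<in> multisets_of_size {0..<?M} r - ?S"
      then obtain i where i: "f i < f (Suc i) + count X (Suc i)"
        by (auto simp: hstrip_def not_le)
      have "Suc i < ?M"
      proof (rule ccontr)
        assume "\<not> Suc i < ?M"
        moreover from this X have "count X (Suc i) = 0"
          by (auto simp: multisets_of_size_def count_eq_zero_iff)
        ultimately show False using i zero[of "Suc i"] by simp
      qed
      thus "det (?B X) = 0"
        using i by (intro det_row_zero[of _ ?M "Suc i"]) simp_all
    qed
  qed (auto intro: finite_multisets_of_size)
  also have "\<dots> = (\<Sum>X\<in>?S. jt ?M (\<lambda>i. f i + count X i))"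
  proof (rule sum.cong[OF refl])
    fix X assume X: "X \<in> ?S"
    hence "f i + count X i \<le> f (i - 1)" if "0 < i" for i
      using that by (cases i) (auto simp: hstrip_def)
    hence "\<not> (0 < i \<and> f (i - 1) < f i + count X i)" for i
      by (metis not_less)
    hence "(if 0 < i \<and> f (i - 1) < f i + count X i then 0 else x) = x" for i and x :: symfun
      by (simp only: if_False)
    thus "det (?B X) = jt ?M (\<lambda>i. f i + count X i)"
      unfolding jt_def by (intro arg_cong[where f = det] eq_matI) simp_all
  qed
  also have "\<dots> = (\<Sum>g\<in>?G. jt ?M g)"
  proof (rule sum.reindex_bij_witness[where j = "\<lambda>X i. f i + count X i"
        and i = "\<lambda>g. \<Sum>i<?M. replicate_mset (g i - f i) i"])
    fix X assume X: "X \<in> ?S"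
    hence out: "count X i = 0" if "?M \<le> i" for i
      using that by (auto simp: multisets_of_size_def count_eq_zero_iff)
    show "(\<Sum>i<?M. replicate_mset (f i + count X i - f i) i) = X"
      using out by (intro multiset_eqI) (auto simp: count_sum simp del: sum.lessThan_Suc)
    show "(\<lambda>i. f i + count X i) \<in> ?G"
      using X sum.mono_neutral_left[of "{..<?M}" "set_mset X" "count X"]
      by (auto simp: sum.distrib multisets_of_size_def lessThan_atLeast0
          size_multiset_overloaded_eq count_eq_zero_iff simp del: sum.lessThan_Suc sum.atLeast0_lessThan_Suc)
  next
    fix g assume g: "g \<in> ?G"
    have 0: "g i = 0" if "?M \<le> i" for i
    proof -
      from that obtain k where k: "i = Suc k" "m \<le> k" by (cases i) auto
      have "g (Suc k) \<le> f k" using g by (simp add: hstrip_def)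
      thus ?thesis using k zero by simp
    qed
    have le: "f i \<le> g i" for i using g by (simp add: hstrip_def)
    define S where "S = (\<Sum>i<?M. replicate_mset (g i - f i) i)"
    have cnt: "count S k = (if k < ?M then g k - f k else 0)" for k
      unfolding S_def by (simp add: count_sum del: sum.lessThan_Suc)
    hence eq: "(\<lambda>i. f i + count S i) = g"
      using le 0 zero by (intro ext) (simp add: not_less)
    thus "(\<lambda>i. f i + count (\<Sum>i<?M. replicate_mset (g i - f i) i) i) = g"
      unfolding S_def .
    have "size S = (\<Sum>i<?M. g i - f i)"
      unfolding S_def by (simp del: sum.lessThan_Suc)
    also have "\<dots> = r"
      using g le by (simp add: sum_subtractf_nat del: sum.lessThan_Suc)
    finally have "size S = r" .
    moreover have "set_mset S \<subseteq> {0..<?M}"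
    proof
      fix x assume "x \<in># S"
      hence "count S x \<noteq> 0" by simp
      thus "x \<in> {0..<?M}" using cnt[of x] by (auto split: if_splits)
    qed
    moreover have "hstrip f (\<lambda>i. f i + count S i)"
      using eq g by simp
    ultimately show "(\<Sum>i<?M. replicate_mset (g i - f i) i) \<in> ?S"
      unfolding S_def[symmetric] multisets_of_size_def by blast
  qed (rule refl)
  finally show ?thesis .
qed

section \<open>Chains of horizontal strips\<close>

lemma hstrip_antimono: "hstrip f g \<Longrightarrow> antimono g"
  unfolding antimono_iff_le_Suc hstrip_def using le_trans by blast

lemma hstrip_zero:
  assumes "hstrip f g" "\<And>r. m \<le> r \<Longrightarrow> f r = 0" "Suc m \<le> r"
  shows "g r = 0"
proof -
  obtain s where s: "r = Suc s" "m \<le> s" using assms(3) by (cases r) auto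
  have "g (Suc s) \<le> f s" using assms(1) by (simp add: hstrip_def)
  thus ?thesis using s assms(2) by simp
qed

text \<open>The size is an integer because Jacobi-Trudi indices can be negative; then no strip
  exists, in accordance with \<open>H a = 0\<close>.\<close>

definition strips :: "nat \<Rightarrow> (nat \<Rightarrow> nat) \<Rightarrow> int \<Rightarrow> (nat \<Rightarrow> nat) set" where
  "strips M f a = {g. hstrip f g \<and> int (sum g {..<M}) = int (sum f {..<M}) + a}"

lemma pieri_strips:
  assumes "\<And>r. m \<le> r \<Longrightarrow> f r = 0" "antimono f" "m < M"
  shows "H a * jt M f = (\<Sum>g\<in>strips M f a. jt M g)"
proof (cases "a < 0")
  case True
  have "g \<notin> strips M f a" for g
  proof
    assume "g \<in> strips M f a"
    hence "hstrip f g" and eq: "int (sum g {..<M}) = int (sum f {..<M}) + a"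
      by (simp_all only: strips_def mem_Collect_eq)
    hence "sum f {..<M} \<le> sum g {..<M}"
      by (intro sum_mono) (auto simp: hstrip_def)
    thus False using eq True by linarith
  qed
  hence "strips M f a = {}" by blast
  thus ?thesis using True by simp
next
  case False
  obtain m' where M: "M = Suc m'" "m \<le> m'" using assms(3) by (cases M) auto
  have "strips M f a = {g. hstrip f g \<and> sum g {..<Suc m'} = sum f {..<Suc m'} + nat a}"
    unfolding strips_def M using False by (intro Collect_cong) linarith
  moreover have "f r = 0" if "m' \<le> r" for r using that M assms(1) by simp
  ultimately show ?thesis
    using pieri[of m' f "nat a"] assms(2) False M by simp
qed

lemma finite_strips:
  assumes "\<And>r. m \<le> r \<Longrightarrow> f r = 0" "m < M"
  shows "finite (strips M f a)"
proof -
  define B where "B = nat (int (sum f {..<M}) + a)"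
  have "strips M f a \<subseteq> {g. \<forall>r. (r \<in> {..<M} \<longrightarrow> g r \<in> {..B}) \<and> (r \<notin> {..<M} \<longrightarrow> g r = 0)}"
  proof
    fix g assume g: "g \<in> strips M f a"
    hence "sum g {..<M} = B"
      unfolding strips_def B_def mem_Collect_eq by linarith
    moreover have "g r \<le> sum g {..<M}" if "r < M" for r
      by (rule member_le_sum) (use that in auto)
    moreover have "g r = 0" if "\<not> r < M" for r
      using g that assms by (intro hstrip_zero[of f g m]) (auto simp: strips_def)
    ultimately show "g \<in> {g. \<forall>r. (r \<in> {..<M} \<longrightarrow> g r \<in> {..B}) \<and> (r \<notin> {..<M} \<longrightarrow> g r = 0)}"
      by auto
  qed
  moreover have "finite \<dots>" by (rule finite_set_of_finite_funs) auto
  ultimately show ?thesis by (rule finite_subset)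
qed

text \<open>Semistandard skew tableaux with content a: the i-th strip holds the cells of the i-th
  letter. Fixing the values beyond n represents each tableau once.\<close>

definition strip_chains :: "nat \<Rightarrow> (nat \<Rightarrow> nat) \<Rightarrow> nat \<Rightarrow> (nat \<Rightarrow> int) \<Rightarrow> (nat \<Rightarrow> nat \<Rightarrow> nat) set" where
  "strip_chains M f n a = {\<kappa>. \<kappa> 0 = f \<and> (\<forall>i<n. \<kappa> (Suc i) \<in> strips M (\<kappa> i) (a i)) \<and> (\<forall>i>n. \<kappa> i = (\<lambda>_. 0))}"

lemma strip_chains_antimono:
  assumes "\<kappa> \<in> strip_chains M f n a" "antimono f" "i \<le> n"
  shows "antimono (\<kappa> i)"
proof (cases i)
  case 0
  thus ?thesis using assms by (simp add: strip_chains_def)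
next
  case (Suc k)
  hence "hstrip (\<kappa> k) (\<kappa> i)"
    using assms by (simp add: strip_chains_def strips_def)
  thus ?thesis by (rule hstrip_antimono)
qed

lemma strip_chains_zero:
  assumes "\<kappa> \<in> strip_chains M f n a" "\<And>r. m \<le> r \<Longrightarrow> f r = 0" "i \<le> n" "m + i \<le> r"
  shows "\<kappa> i r = 0"
  using assms(3,4)
proof (induction i arbitrary: r)
  case 0
  thus ?case using assms(1,2) by (simp add: strip_chains_def)
next
  case (Suc i)
  have "hstrip (\<kappa> i) (\<kappa> (Suc i))"
    using assms(1) Suc.prems by (simp add: strip_chains_def strips_def)
  thus ?case
    by (rule hstrip_zero[where m = "m + i"]) (use Suc in auto)
qed

lemma strip_chains_Suc:
  "bij_betw (\<lambda>(\<kappa>, g). \<kappa>(Suc n := g)) (SIGMA \<kappa>:strip_chains M f n a. strips M (\<kappa> n) (a n)) (strip_chains M f (Suc n) a)"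
proof (rule bij_betw_byWitness[where f' = "\<lambda>\<kappa>. (\<kappa>(Suc n := (\<lambda>_. 0)), \<kappa> (Suc n))"])
  show "\<forall>p\<in>SIGMA \<kappa>:strip_chains M f n a. strips M (\<kappa> n) (a n).
      (\<lambda>\<kappa>. (\<kappa>(Suc n := (\<lambda>_. 0)), \<kappa> (Suc n))) ((\<lambda>(\<kappa>, g). \<kappa>(Suc n := g)) p) = p"
    by (auto simp: strip_chains_def fun_eq_iff)
  show "\<forall>\<kappa>\<in>strip_chains M f (Suc n) a.
      (\<lambda>(\<kappa>, g). \<kappa>(Suc n := g)) (\<kappa>(Suc n := (\<lambda>_. 0)), \<kappa> (Suc n)) = \<kappa>"
    by auto
  show "(\<lambda>(\<kappa>, g). \<kappa>(Suc n := g)) ` (SIGMA \<kappa>:strip_chains M f n a. strips M (\<kappa> n) (a n)) \<subseteq> strip_chains M f (Suc n) a"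
    by (auto simp: strip_chains_def less_Suc_eq)
  show "(\<lambda>\<kappa>. (\<kappa>(Suc n := (\<lambda>_. 0)), \<kappa> (Suc n))) ` strip_chains M f (Suc n) a \<subseteq>
      (SIGMA \<kappa>:strip_chains M f n a. strips M (\<kappa> n) (a n))"
    by (auto simp: strip_chains_def)
qed

lemma strip_chains_0: "strip_chains M f 0 a = {\<lambda>i. if i = 0 then f else (\<lambda>_. 0)}"
  by (auto simp: strip_chains_def fun_eq_iff)

lemma finite_strip_chains:
  assumes "\<And>r. m \<le> r \<Longrightarrow> f r = 0" "m + n \<le> M"
  shows "finite (strip_chains M f n a)"
  using assms(2)
proof (induction n)
  case 0
  show ?case by (simp add: strip_chains_0)
next
  case (Suc n)
  have "finite (strips M (\<kappa> n) (a n))" if "\<kappa> \<in> strip_chains M f n a" for \<kappa>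
    by (rule finite_strips[of "m + n"]) (use strip_chains_zero[OF that assms(1)] Suc.prems in auto)
  with Suc have "finite (SIGMA \<kappa>:strip_chains M f n a. strips M (\<kappa> n) (a n))"
    by (intro finite_SigmaI) auto
  thus ?case
    using bij_betw_finite[OF strip_chains_Suc] by blast
qed

text \<open>Iterated Pieri rule; a strip adds at most one row, so m + n rows suffice
  throughout.\<close>

lemma prod_H_mult_jt:
  assumes "\<And>r. m \<le> r \<Longrightarrow> f r = 0" "antimono f" "m + n \<le> M"
  shows "(\<Prod>i<n. H (a i)) * jt M f = (\<Sum>\<kappa>\<in>strip_chains M f n a. jt M (\<kappa> n))"
  using assms(3)
proof (induction n)
  case 0
  show ?case by (simp add: strip_chains_0)
next
  case (Suc n)
  have "(\<Prod>i<Suc n. H (a i)) * jt M f = (\<Sum>\<kappa>\<in>strip_chains M f n a. H (a n) * jt M (\<kappa> n))"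
    using Suc by (simp add: mult_ac flip: sum_distrib_left)
  also have "\<dots> = (\<Sum>\<kappa>\<in>strip_chains M f n a. \<Sum>g\<in>strips M (\<kappa> n) (a n). jt M g)"
  proof (rule sum.cong[OF refl])
    fix \<kappa> assume \<kappa>: "\<kappa> \<in> strip_chains M f n a"
    show "H (a n) * jt M (\<kappa> n) = (\<Sum>g\<in>strips M (\<kappa> n) (a n). jt M g)"
      by (rule pieri_strips[of "m + n"])
        (use strip_chains_zero[OF \<kappa> assms(1)] strip_chains_antimono[OF \<kappa> assms(2)] Suc.prems in auto)
  qed
  also have "\<dots> = (\<Sum>p\<in>(SIGMA \<kappa>:strip_chains M f n a. strips M (\<kappa> n) (a n)). jt M (snd p))"
  proof (subst sum.Sigma)
    show "finite (strip_chains M f n a)"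
      by (rule finite_strip_chains[OF assms(1)]) (use Suc.prems in auto)
    show "\<forall>\<kappa>\<in>strip_chains M f n a. finite (strips M (\<kappa> n) (a n))"
    proof
      fix \<kappa> assume \<kappa>: "\<kappa> \<in> strip_chains M f n a"
      show "finite (strips M (\<kappa> n) (a n))"
        by (rule finite_strips[of "m + n"]) (use strip_chains_zero[OF \<kappa> assms(1)] Suc.prems in auto)
    qed
  qed (simp add: case_prod_unfold)
  also have "\<dots> = (\<Sum>\<kappa>\<in>strip_chains M f (Suc n) a. jt M (\<kappa> (Suc n)))"
    by (subst sum.reindex_bij_betw[OF strip_chains_Suc, symmetric]) (simp add: case_prod_unfold)
  finally show ?case .
qed

section \<open>The Bender--Knuth involution\<close>

text \<open>For a chain \<open>\<kappa>\<close> of partitions with at most \<open>M\<close> rows, \<open>excess M (\<kappa> i) j\<close> counts the cells beyond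
  column \<open>j\<close>; it is concave in \<open>i\<close> iff the content of the strips beyond column \<open>j\<close> is weakly
  decreasing.  The involution acts on the first \<open>j\<close> columns only, where row \<open>r\<close> of the middle
  partition ranges freely over the interval from \<open>lo\<close> to \<open>hi\<close> and is reflected in it.\<close>

definition excess :: "nat \<Rightarrow> (nat \<Rightarrow> nat) \<Rightarrow> nat \<Rightarrow> nat" where
  "excess M g j = (\<Sum>r<M. g r - j)"

definition lo :: "nat \<Rightarrow> (nat \<Rightarrow> nat) \<Rightarrow> (nat \<Rightarrow> nat) \<Rightarrow> nat \<Rightarrow> nat" where
  "lo j a b r = max (min (a r) j) (min (b (Suc r)) j)"

definition hi :: "nat \<Rightarrow> (nat \<Rightarrow> nat) \<Rightarrow> (nat \<Rightarrow> nat) \<Rightarrow> nat \<Rightarrow> nat" where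
  "hi j a b r = (case r of 0 \<Rightarrow> min (b 0) j | Suc s \<Rightarrow> min (min (b (Suc s)) j) (min (a s) j))"

definition toggle :: "nat \<Rightarrow> (nat \<Rightarrow> nat) \<Rightarrow> (nat \<Rightarrow> nat) \<Rightarrow> (nat \<Rightarrow> nat) \<Rightarrow> nat \<Rightarrow> nat" where
  "toggle j a b x r = (if j < x r then x r else lo j a b r + hi j a b r - x r)"

text \<open>\<open>lo\<close> in row r and \<open>hi\<close> in row r + 1 are the maximum and the
  minimum of the same two numbers, so together they give their sum; \<open>b M = 0\<close> closes
  the bottom row.\<close>

lemma sum_lo_hi:
  assumes "b M = 0"
  shows "(\<Sum>r<M. lo j a b r + hi j a b r) = (\<Sum>r<M. min (a r) j) + (\<Sum>r<M. min (b r) j)"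
proof (cases M)
  case 0
  thus ?thesis by simp
next
  case (Suc N)
  have "(\<Sum>r<M. lo j a b r) = (\<Sum>r<N. max (min (a r) j) (min (b (Suc r)) j)) + min (a N) j"
    using assms by (simp add: Suc lo_def)
  moreover have "(\<Sum>r<M. hi j a b r) = min (b 0) j + (\<Sum>r<N. min (min (b (Suc r)) j) (min (a r) j))"
    unfolding Suc sum.lessThan_Suc_shift by (simp add: hi_def)
  moreover have "(\<Sum>r<N. max (min (a r) j) (min (b (Suc r)) j)) + (\<Sum>r<N. min (min (b (Suc r)) j) (min (a r) j)) =
      (\<Sum>r<N. min (a r) j) + (\<Sum>r<N. min (b (Suc r)) j)"
    unfolding sum.distrib[symmetric] by (intro sum.cong refl) linarith
  moreover have "(\<Sum>r<M. min (b r) j) = min (b 0) j + (\<Sum>r<N. min (b (Suc r)) j)"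
    unfolding Suc sum.lessThan_Suc_shift by simp
  ultimately show ?thesis
    by (simp add: sum.distrib Suc)
qed

text \<open>Counting columns from 0, \<open>col\<close> says that the strip from a to x has no cell
  in column j, the first one that is not reflected.\<close>

context
  fixes a x b :: "nat \<Rightarrow> nat" and j :: nat
  assumes ax: "hstrip a x" and xb: "hstrip x b" and col: "\<And>r. j < x r \<Longrightarrow> j < a r"
begin

lemma interlace:
  "a r \<le> x r" "x r \<le> b r" "x (Suc r) \<le> a r" "b (Suc r) \<le> x r"
  using ax xb by (auto simp: hstrip_def)

lemma toggle_bounds:
  assumes "x r \<le> j"
  shows "lo j a b r \<le> x r" "x r \<le> hi j a b r"
  using assms interlace[of r] interlace[of "r - 1"]
  by (auto simp: lo_def hi_def split: nat.split)

text \<open>Rows of x that cross the cut have a one-point interval, so keeping them fixed is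
  consistent with reflecting their truncations. This is where \<open>col\<close> enters.\<close>

lemma lo_hi_eq:
  assumes "j < x r"
  shows "lo j a b r = j" "hi j a b r = j"
proof -
  have "j < a r" "j < b r" using col[OF assms] assms interlace(2)[of r] by auto
  moreover have "j < a s" if "r = Suc s" for s
    using that assms interlace(3)[of s] by simp
  ultimately show "lo j a b r = j" "hi j a b r = j"
    by (auto simp: lo_def hi_def split: nat.split)
qed

lemma toggle_le_iff: "j < toggle j a b x r \<longleftrightarrow> j < x r"
  using toggle_bounds[of r] by (auto simp: toggle_def hi_def split: nat.splits)

text \<open>The reflection is invisible to \<open>excess\<close> from column j on, so the place of
  the cut can be recovered afterwards.\<close>

lemma toggle_diff: "j \<le> j' \<Longrightarrow> toggle j a b x r - j' = x r - j'"
  using toggle_le_iff[of r] by (auto simp: toggle_def not_less split: if_splits)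

lemma toggle_toggle: "toggle j a b (toggle j a b x) = x"
proof
  fix r
  show "toggle j a b (toggle j a b x) r = x r"
    using toggle_bounds[of r] toggle_le_iff[of r]
    by (cases "j < x r") (simp_all add: toggle_def)
qed

lemma toggle_lo_hi: "x r \<le> j \<Longrightarrow> lo j a b r \<le> toggle j a b x r \<and> toggle j a b x r \<le> hi j a b r"
  using toggle_bounds[of r] by (auto simp: toggle_def)

lemma hstrip_toggle: "hstrip a (toggle j a b x)" "hstrip (toggle j a b x) b"
proof -
  have "a r \<le> toggle j a b x r \<and> b (Suc r) \<le> toggle j a b x r \<and> toggle j a b x r \<le> b r" for r
  proof (cases "x r \<le> j")
    case True
    thus ?thesis
      using toggle_lo_hi[OF True] interlace[of r] by (auto simp: lo_def hi_def split: nat.splits)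
  next
    case False
    thus ?thesis using interlace[of r] by (simp add: toggle_def)
  qed
  moreover have "toggle j a b x (Suc r) \<le> a r" for r
  proof (cases "x (Suc r) \<le> j")
    case True
    thus ?thesis using toggle_lo_hi[OF True] by (simp add: hi_def)
  next
    case False
    thus ?thesis using interlace[of r] by (simp add: toggle_def)
  qed
  ultimately show "hstrip a (toggle j a b x)" "hstrip (toggle j a b x) b"
    by (simp_all add: hstrip_def)
qed

text \<open>Left of the cut, old and new middle sizes add up to the outer ones by
  \<open>sum_lo_hi\<close>; beyond it the middle partition counts twice. The \<open>excess\<close>
  terms convert truncated sizes to full ones without subtraction.\<close>

lemma sum_toggle:
  assumes "b M = 0"
  shows "sum (toggle j a b x) {..<M} + sum x {..<M} + excess M a j + excess M b j =
    sum a {..<M} + sum b {..<M} + 2 * excess M x j"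
proof -
  have "toggle j a b x r + x r = lo j a b r + hi j a b r + 2 * (x r - j)" for r
    using toggle_bounds[of r] lo_hi_eq[of r] by (cases "j < x r") (simp_all add: toggle_def)
  hence "sum (toggle j a b x) {..<M} + sum x {..<M} =
      (\<Sum>r<M. lo j a b r + hi j a b r) + 2 * excess M x j"
    by (simp add: excess_def sum_distrib_left flip: sum.distrib)
  moreover have "(\<Sum>r<M. min (c r) j) + excess M c j = sum c {..<M}" for c
    unfolding excess_def sum.distrib[symmetric] by (intro sum.cong) auto
  from this[of a] this[of b]
  have "(\<Sum>r<M. lo j a b r + hi j a b r) + excess M a j + excess M b j = sum a {..<M} + sum b {..<M}"
    unfolding sum_lo_hi[of b M j a, OF assms] by linarith
  ultimately show ?thesis by linarith
qed

end

section \<open>Column lengths and breaks of concavity\<close>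

lemma excess_Suc: "excess M g j = excess M g (Suc j) + (\<Sum>r<M. of_bool (j < g r))"
  unfolding excess_def sum.distrib[symmetric] by (intro sum.cong) auto

lemma column_length_strip:
  assumes "hstrip a x"
  shows "(\<Sum>r<M. of_bool (j < a r)) \<le> (\<Sum>r<M. of_bool (j < x r) :: nat)"
    and "(\<Sum>r<M. of_bool (j < x r)) \<le> Suc (\<Sum>r<M. of_bool (j < a r))"
proof -
  have le: "a r \<le> x r" "x (Suc r) \<le> a r" for r using assms by (auto simp: hstrip_def)
  show "(\<Sum>r<M. of_bool (j < a r)) \<le> (\<Sum>r<M. of_bool (j < x r) :: nat)"
    by (intro sum_mono) (use le in \<open>auto simp: of_bool_def intro: less_le_trans\<close>)
  show "(\<Sum>r<M. of_bool (j < x r)) \<le> Suc (\<Sum>r<M. of_bool (j < a r))"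
  proof (cases M)
    case (Suc N)
    have "(\<Sum>r<M. of_bool (j < x r)) = of_bool (j < x 0) + (\<Sum>r<N. of_bool (j < x (Suc r)) :: nat)"
      unfolding Suc sum.lessThan_Suc_shift by simp
    also have "(\<Sum>r<N. of_bool (j < x (Suc r))) \<le> (\<Sum>r<N. of_bool (j < a r) :: nat)"
      by (intro sum_mono) (use le in \<open>auto simp: of_bool_def intro: less_le_trans\<close>)
    also have "\<dots> \<le> (\<Sum>r<M. of_bool (j < a r))" unfolding Suc by simp
    finally show ?thesis by (auto simp: of_bool_def split: if_splits)
  qed simp
qed

text \<open>A horizontal strip has at most one cell in column \<open>j\<close>, so passing from the columns beyond
  \<open>j + 1\<close> to those beyond \<open>j\<close> changes the defect of concavity by at most one.\<close>

lemma excess_break: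
  assumes ax: "hstrip a x" and xb: "hstrip x b" and zero: "\<And>r. M \<le> r \<Longrightarrow> x r = 0"
    and fail: "2 * excess M x j < excess M a j + excess M b j"
    and ok: "excess M a (Suc j) + excess M b (Suc j) \<le> 2 * excess M x (Suc j)"
  shows "2 * excess M x j + 1 = excess M a j + excess M b j"
    and "j < x r \<Longrightarrow> j < a r"
proof -
  define k where "k g = (\<Sum>r<M. of_bool (j < g r) :: nat)" for g
  have e: "excess M g j = excess M g (Suc j) + k g" for g
    unfolding k_def by (rule excess_Suc)
  have k: "k a \<le> k x" "k x \<le> Suc (k a)" "k x \<le> k b" "k b \<le> Suc (k x)"
    unfolding k_def using column_length_strip[OF ax] column_length_strip[OF xb] by auto
  from fail ok k show "2 * excess M x j + 1 = excess M a j + excess M b j"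
    unfolding e[of a] e[of b] e[of x] by simp
  \<comment> \<open>The defect grows by (k b - k x) - (k x - k a) with both brackets 0 or 1. It must
    grow, so the second bracket is 0: the lower strip misses column j.\<close>
  from fail ok k have eq: "k x = k a"
    unfolding e[of a] e[of b] e[of x] by simp
  show "j < a r" if "j < x r"
  proof (rule ccontr)
    assume "\<not> j < a r"
    have "r < M" using that zero[of r] by (cases "r < M") auto
    have le: "of_bool (j < a s) \<le> (of_bool (j < x s) :: nat)" for s
      using ax by (auto simp: hstrip_def of_bool_def intro: less_le_trans)
    have "k a < k x"
      unfolding k_def
      by (rule sum_strict_mono_ex1) (use le that \<open>\<not> j < a r\<close> \<open>r < M\<close> in \<open>auto intro!: bexI[of _ r]\<close>)
    thus False using eq by simp
  qed
qed

section \<open>The Littlewood--Richardson rule\<close>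

text \<open>Violation of the lattice condition, read by columns from the right: from column j on,
  letter i + 1 occurs more often than letter i.\<close>

definition breaks :: "nat \<Rightarrow> nat \<Rightarrow> (nat \<Rightarrow> nat \<Rightarrow> nat) \<Rightarrow> nat \<Rightarrow> nat \<Rightarrow> bool" where
  "breaks M n \<kappa> j i \<longleftrightarrow> Suc i < n \<and>
     2 * excess M (\<kappa> (Suc i)) j < excess M (\<kappa> i) j + excess M (\<kappa> (Suc (Suc i))) j"

definition bad :: "nat \<Rightarrow> nat \<Rightarrow> (nat \<Rightarrow> nat \<Rightarrow> nat) \<Rightarrow> bool" where
  "bad M n \<kappa> \<longleftrightarrow> (\<exists>j i. breaks M n \<kappa> j i)"

text \<open>The greatest column is chosen so that the next one is free of breaks, as
  \<open>excess_break\<close> requires.\<close>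

definition pivot_col :: "nat \<Rightarrow> nat \<Rightarrow> (nat \<Rightarrow> nat \<Rightarrow> nat) \<Rightarrow> nat" where
  "pivot_col M n \<kappa> = (GREATEST j. \<exists>i. breaks M n \<kappa> j i)"

definition pivot_row :: "nat \<Rightarrow> nat \<Rightarrow> (nat \<Rightarrow> nat \<Rightarrow> nat) \<Rightarrow> nat" where
  "pivot_row M n \<kappa> = (LEAST i. breaks M n \<kappa> (pivot_col M n \<kappa>) i)"

definition flip :: "nat \<Rightarrow> nat \<Rightarrow> (nat \<Rightarrow> nat \<Rightarrow> nat) \<Rightarrow> nat \<Rightarrow> nat \<Rightarrow> nat" where
  "flip M n \<kappa> = (let i = pivot_row M n \<kappa> in
     \<kappa>(Suc i := toggle (pivot_col M n \<kappa>) (\<kappa> i) (\<kappa> (Suc (Suc i))) (\<kappa> (Suc i))))"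

text \<open>Beyond the total size every \<open>excess\<close> vanishes; this bound makes the
  \<open>GREATEST\<close> in \<open>pivot_col\<close> meaningful.\<close>

lemma breaks_bound:
  assumes "breaks M n \<kappa> j i"
  shows "j \<le> (\<Sum>i\<le>n. \<Sum>r<M. \<kappa> i r)"
proof (rule ccontr)
  assume j: "\<not> ?thesis"
  have "\<kappa> i' r \<le> j" if "i' \<le> n" "r < M" for i' r
  proof -
    have "\<kappa> i' r \<le> (\<Sum>r<M. \<kappa> i' r)" by (rule member_le_sum) (use that in auto)
    also have "\<dots> \<le> (\<Sum>i\<le>n. \<Sum>r<M. \<kappa> i r)"
      by (rule member_le_sum[where f = "\<lambda>i. \<Sum>r<M. \<kappa> i r"]) (use that in auto)
    finally show ?thesis using j by simp
  qed
  hence "excess M (\<kappa> i') j = 0" if "i' \<le> n" for i'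
    unfolding excess_def using that by (intro sum.neutral) simp
  from this[of i] this[of "Suc (Suc i)"] assms show False
    by (simp add: breaks_def)
qed

lemma pivot:
  assumes "bad M n \<kappa>"
  shows "breaks M n \<kappa> (pivot_col M n \<kappa>) (pivot_row M n \<kappa>)"
    and "pivot_col M n \<kappa> < j \<Longrightarrow> \<not> breaks M n \<kappa> j i"
proof -
  let ?P = "\<lambda>j. \<exists>i. breaks M n \<kappa> j i"
  from assms obtain j0 where j0: "?P j0" by (auto simp: bad_def)
  have bound: "y \<le> (\<Sum>i\<le>n. \<Sum>r<M. \<kappa> i r)" if "?P y" for y
    using that breaks_bound by blast
  have "?P (pivot_col M n \<kappa>)"
    unfolding pivot_col_def by (rule GreatestI_nat[of ?P, OF j0 bound])
  thus "breaks M n \<kappa> (pivot_col M n \<kappa>) (pivot_row M n \<kappa>)"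
    unfolding pivot_row_def by (rule LeastI_ex)
  show "\<not> breaks M n \<kappa> j i" if "pivot_col M n \<kappa> < j"
    using Greatest_le_nat[of ?P j, OF _ bound] that unfolding pivot_col_def by (meson not_le)
qed

text \<open>Both pivots are determined by the breaks from the pivot column on, precisely the data
  that \<open>flip\<close> preserves; hence \<open>flip\<close> can be undone.\<close>

lemma pivot_cong:
  assumes bad: "bad M n \<kappa>"
    and eq: "\<And>j i. pivot_col M n \<kappa> \<le> j \<Longrightarrow> breaks M n \<kappa>' j i \<longleftrightarrow> breaks M n \<kappa> j i"
  shows "bad M n \<kappa>'" "pivot_col M n \<kappa>' = pivot_col M n \<kappa>" "pivot_row M n \<kappa>' = pivot_row M n \<kappa>"
proof -
  show bad': "bad M n \<kappa>'"
    using pivot(1)[OF bad] eq unfolding bad_def by blast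
  show col: "pivot_col M n \<kappa>' = pivot_col M n \<kappa>"
  proof (rule antisym)
    show "pivot_col M n \<kappa>' \<le> pivot_col M n \<kappa>"
      using pivot(1)[OF bad'] pivot(2)[OF bad] eq by (meson less_imp_le not_le)
    show "pivot_col M n \<kappa> \<le> pivot_col M n \<kappa>'"
      using pivot(1)[OF bad] pivot(2)[OF bad'] eq by (meson le_refl not_le)
  qed
  show "pivot_row M n \<kappa>' = pivot_row M n \<kappa>"
    unfolding pivot_row_def col using eq[OF order_refl] by presburger
qed

text \<open>The sizes of the two strips are exchanged left of the cut; the defect of exactly one
  beyond it shifts the totals by one.\<close>

lemma flip:
  assumes \<kappa>: "\<kappa> \<in> strip_chains M f n a" and bad: "bad M n \<kappa>"
    and zero: "\<And>r. m \<le> r \<Longrightarrow> f r = 0" and M: "m + n \<le> M"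
  defines "i \<equiv> pivot_row M n \<kappa>"
  shows "flip M n \<kappa> \<in> strip_chains M f n (a(i := a (Suc i) - 1, Suc i := a i + 1))"
    and "bad M n (flip M n \<kappa>)" "pivot_row M n (flip M n \<kappa>) = i"
    and "flip M n (flip M n \<kappa>) = \<kappa>" "flip M n \<kappa> n = \<kappa> n" "Suc i < n"
proof -
  define j where "j = pivot_col M n \<kappa>"
  define t where "t = toggle j (\<kappa> i) (\<kappa> (Suc (Suc i))) (\<kappa> (Suc i))"
  have flip_eq: "flip M n \<kappa> = \<kappa>(Suc i := t)"
    by (simp add: flip_def t_def i_def j_def Let_def)
  \<comment> \<open>Maximality of the pivot column supplies the inequality at \<open>Suc j\<close>
    for \<open>excess_break\<close>.\<close>
  have brk: "breaks M n \<kappa> j i" and nbrk: "\<not> breaks M n \<kappa> (Suc j) i"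
    using pivot[OF bad] by (auto simp: i_def j_def)
  show i: "Suc i < n" using brk by (simp add: breaks_def)
  have st: "\<kappa> (Suc i) \<in> strips M (\<kappa> i) (a i)" "\<kappa> (Suc (Suc i)) \<in> strips M (\<kappa> (Suc i)) (a (Suc i))"
    using \<kappa> i by (simp_all add: strip_chains_def)
  hence ax: "hstrip (\<kappa> i) (\<kappa> (Suc i))" and xb: "hstrip (\<kappa> (Suc i)) (\<kappa> (Suc (Suc i)))"
    by (simp_all add: strips_def)
  have zx: "\<kappa> (Suc i) r = 0" and zb: "\<kappa> (Suc (Suc i)) r = 0" if "M \<le> r" for r
    using strip_chains_zero[OF \<kappa> zero, of m "Suc i" r] strip_chains_zero[OF \<kappa> zero, of m "Suc (Suc i)" r]
      i M that by simp_all
  note brk' = excess_break[OF ax xb zx, of M j]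
  have one: "2 * excess M (\<kappa> (Suc i)) j + 1 = excess M (\<kappa> i) j + excess M (\<kappa> (Suc (Suc i))) j"
    and col: "\<And>r. j < \<kappa> (Suc i) r \<Longrightarrow> j < \<kappa> i r"
    using brk' brk nbrk i by (auto simp: breaks_def not_less)
  note tog = hstrip_toggle[OF ax xb col, folded t_def] toggle_toggle[OF ax xb col, folded t_def]
  have sum_t: "sum t {..<M} + sum (\<kappa> (Suc i)) {..<M} + 1 = sum (\<kappa> i) {..<M} + sum (\<kappa> (Suc (Suc i))) {..<M}"
    using sum_toggle[OF ax xb col, folded t_def, of M] zb[of M] one by simp
  have "t \<in> strips M (\<kappa> i) (a (Suc i) - 1)" "\<kappa> (Suc (Suc i)) \<in> strips M t (a i + 1)"
    using st sum_t tog(1,2) unfolding strips_def mem_Collect_eq by linarith+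
  with \<kappa> i show "flip M n \<kappa> \<in> strip_chains M f n (a(i := a (Suc i) - 1, Suc i := a i + 1))"
    unfolding flip_eq by (auto simp: strip_chains_def)
  have exc: "excess M ((\<kappa>(Suc i := t)) k) j' = excess M (\<kappa> k) j'" if "j \<le> j'" for j' k
    using toggle_diff[OF ax xb col that, folded t_def] by (simp add: excess_def)
  have eq: "breaks M n (flip M n \<kappa>) j' i' \<longleftrightarrow> breaks M n \<kappa> j' i'"
    if "pivot_col M n \<kappa> \<le> j'" for j' i'
    using that exc unfolding breaks_def flip_eq j_def by metis
  note piv = pivot_cong[OF bad eq]
  show "bad M n (flip M n \<kappa>)" by (rule piv)
  show "pivot_row M n (flip M n \<kappa>) = i" using piv by (simp add: i_def)
  show "flip M n \<kappa> n = \<kappa> n" using i by (simp add: flip_eq)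
  have "flip M n (flip M n \<kappa>) =
      (flip M n \<kappa>)(Suc i := toggle j (flip M n \<kappa> i) (flip M n \<kappa> (Suc (Suc i))) (flip M n \<kappa> (Suc i)))"
    using piv by (simp add: flip_def[of M n "flip M n \<kappa>"] i_def j_def Let_def)
  also have "\<dots> = \<kappa>"
    unfolding flip_eq using tog(3) by (simp add: fun_eq_iff)
  finally show "flip M n (flip M n \<kappa>) = \<kappa>" .
qed

section \<open>The signed sum over permutations and its cancellation\<close>

definition jt_content :: "nat list \<Rightarrow> (nat \<Rightarrow> nat) \<Rightarrow> nat \<Rightarrow> int" where
  "jt_content \<mu> w i = int (\<mu> ! w i) - int (w i) + int i"

text \<open>Expansion along columns: the order of the strips is the order of the columns, so
  neighbouring strips are exchanged by composing w on the right with a transposition.\<close>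

lemma schur_eq_sum:
  "schur \<mu> = (\<Sum>w | w permutes {0..<length \<mu>}. signof w * (\<Prod>i<length \<mu>. H (jt_content \<mu> w i)))"
  unfolding schur_def det_col[OF mat_carrier] jt_content_def
  by (intro sum.cong prod.cong refl arg_cong2[where f = "(*)"]) (simp add: permutes_lessI)

text \<open>Exactly the change of strip sizes in \<open>flip\<close>; the shifts come from the
  summand \<open>int i\<close>, which stays with the column.\<close>

lemma jt_content_transpose:
  "jt_content \<mu> (w \<circ> Transposition.transpose i (Suc i)) =
    (jt_content \<mu> w)(i := jt_content \<mu> w (Suc i) - 1, Suc i := jt_content \<mu> w i + 1)"
  by (auto simp: fun_eq_iff jt_content_def Transposition.transpose_def)

text \<open>Without breaks at column 0 the content is weakly decreasing. As \<mu>_i - i is strictly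
  decreasing, this forces w to be increasing.\<close>

lemma content_not_bad:
  assumes \<mu>: "\<mu> \<in> partitions" and w: "w permutes {0..<length \<mu>}"
    and \<kappa>: "\<kappa> \<in> strip_chains M f (length \<mu>) (jt_content \<mu> w)" and nbad: "\<not> bad M (length \<mu>) \<kappa>"
  shows "w = id"
proof -
  let ?n = "length \<mu>"
  have dec: "w i < w (Suc i)" if i: "Suc i < ?n" for i
  proof (rule ccontr)
    assume not: "\<not> w i < w (Suc i)"
    have "\<mu> ! w i \<le> \<mu> ! w (Suc i)"
      using \<mu> not permutes_lessI[OF w, of i] i
      by (cases "w i = w (Suc i)") (auto simp: partitions_def sorted_wrt_iff_nth_less)
    moreover have "excess M (\<kappa> i) 0 + excess M (\<kappa> (Suc (Suc i))) 0 \<le> 2 * excess M (\<kappa> (Suc i)) 0"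
      using nbad i unfolding bad_def breaks_def by (meson not_less)
    hence "sum (\<kappa> i) {..<M} + sum (\<kappa> (Suc (Suc i))) {..<M} \<le> 2 * sum (\<kappa> (Suc i)) {..<M}"
      by (simp add: excess_def)
    moreover have "\<kappa> (Suc i) \<in> strips M (\<kappa> i) (jt_content \<mu> w i)"
      "\<kappa> (Suc (Suc i)) \<in> strips M (\<kappa> (Suc i)) (jt_content \<mu> w (Suc i))"
      using \<kappa> i by (simp_all add: strip_chains_def)
    ultimately show False
      using not unfolding strips_def mem_Collect_eq jt_content_def by linarith
  qed
  have "i \<le> w i" if "i < ?n" for i
    using that
  proof (induction i)
    case (Suc i)
    thus ?case using dec[of i] by simp
  qed simp
  thus ?thesis
    using w by (intro permutes_natset_ge) auto
qed

text \<open>The surviving chains are the Littlewood-Richardson tableaux with content \<mu>.\<close>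

theorem jt_mult_schur:
  assumes \<mu>: "\<mu> \<in> partitions" and zero: "\<And>r. m \<le> r \<Longrightarrow> f r = 0" and anti: "antimono f"
    and M: "m + length \<mu> \<le> M"
  shows "jt M f * schur \<mu> =
    (\<Sum>\<kappa> | \<kappa> \<in> strip_chains M f (length \<mu>) (\<lambda>i. int (\<mu> ! i)) \<and> \<not> bad M (length \<mu>) \<kappa>. jt M (\<kappa> (length \<mu>)))"
proof -
  define n where "n = length \<mu>"
  define W where "W = {w. w permutes {0..<n}}"
  define X where "X = (SIGMA w:W. strip_chains M f n (jt_content \<mu> w))"
  define wt where "wt = (\<lambda>(w, \<kappa>). signof w * jt M (\<kappa> n))"
  define B where "B = {(w, \<kappa>)\<in>X. bad M n \<kappa>}"
  have finW: "finite W" unfolding W_def by (rule finite_permutations) simp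
  have finC: "finite (strip_chains M f n a)" for a
    by (rule finite_strip_chains[OF zero]) (use M n_def in auto)
  have finX: "finite X"
    unfolding X_def using finW finC by (intro finite_SigmaI)
  have "jt M f * schur \<mu> = (\<Sum>w\<in>W. signof w * ((\<Prod>i<n. H (jt_content \<mu> w i)) * jt M f))"
    unfolding schur_eq_sum W_def n_def sum_distrib_left by (intro sum.cong refl) (simp only: mult_ac)
  also have "\<dots> = (\<Sum>w\<in>W. \<Sum>\<kappa>\<in>strip_chains M f n (jt_content \<mu> w). signof w * jt M (\<kappa> n))"
    by (subst prod_H_mult_jt[OF zero anti]) (use M n_def in \<open>auto simp: sum_distrib_left\<close>)
  also have "\<dots> = sum wt X"
    unfolding X_def wt_def using finW finC by (subst sum.Sigma) auto
  also have "\<dots> = sum wt (X - B) + sum wt B"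
    by (rule sum.subset_diff[OF _ finX]) (auto simp: B_def)
  also have "sum wt B = 0"
  proof -
    define \<Phi> where "\<Phi> = (\<lambda>(w :: nat \<Rightarrow> nat, \<kappa>). let i = pivot_row M n \<kappa> in
      (w \<circ> Transposition.transpose i (Suc i), flip M n \<kappa>))"
    have \<Phi>: "\<Phi> p \<in> B \<and> \<Phi> (\<Phi> p) = p \<and> wt (\<Phi> p) = - wt p" if "p \<in> B" for p
    proof -
      obtain w \<kappa> where p: "p = (w, \<kappa>)" by force
      define i where "i = pivot_row M n \<kappa>"
      let ?t = "Transposition.transpose i (Suc i)"
      from that p have w: "w permutes {0..<n}" and \<kappa>: "\<kappa> \<in> strip_chains M f n (jt_content \<mu> w)"
        and bad: "bad M n \<kappa>" by (auto simp: B_def X_def W_def)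
      note fl = flip[OF \<kappa> bad zero, folded i_def]
      have mn: "m + n \<le> M" using M by (simp add: n_def)
      have i: "Suc i < n" by (rule fl(6)[OF _ mn])
      have t: "?t permutes {0..<n}"
        by (rule permutes_swap_id) (use i in auto)
      have "w \<circ> ?t permutes {0..<n}"
        by (rule permutes_compose[OF t w])
      moreover have "flip M n \<kappa> \<in> strip_chains M f n (jt_content \<mu> (w \<circ> ?t))"
        unfolding jt_content_transpose by (rule fl(1)[OF _ mn])
      ultimately have \<Phi>B: "\<Phi> p \<in> B"
        using fl(2)[OF _ mn] by (simp add: \<Phi>_def p B_def X_def W_def Let_def flip: i_def)
      have \<Phi>\<Phi>: "\<Phi> (\<Phi> p) = p"
        using fl(3,4)[OF _ mn] by (simp add: \<Phi>_def p Let_def comp_assoc flip: i_def)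
      have "sign (w \<circ> ?t) = - sign w"
        using sign_compose[of w ?t] permutes_imp_permutation[OF _ w] permutes_imp_permutation[OF _ t]
        by (simp add: sign_swap_id)
      moreover have "flip M n \<kappa> n = \<kappa> n" by (rule fl(5)[OF _ mn])
      ultimately have "wt (\<Phi> p) = - wt p"
        by (simp add: wt_def \<Phi>_def p Let_def flip: i_def)
      with \<Phi>B \<Phi>\<Phi> show ?thesis by blast
    qed
    have "sum wt B = sum (\<lambda>p. - wt p) B"
      by (rule sum.reindex_bij_witness[where i = \<Phi> and j = \<Phi>]) (use \<Phi> in auto)
    \<comment> \<open>Over the reals a sum equal to its own negative vanishes.\<close>
    hence "2 *\<^sub>R sum wt B = 0"
      by (simp add: sum_negf scaleR_2)
    thus ?thesis by simp
  qed
  also have "sum wt (X - B) + 0 = sum wt (X - B)" by simp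
  also have "X - B = Pair (id :: nat \<Rightarrow> nat) ` {\<kappa>. \<kappa> \<in> strip_chains M f n (jt_content \<mu> id) \<and> \<not> bad M n \<kappa>}" (is "_ = _ ` ?G")
  proof (intro equalityI subsetI)
    fix p assume p: "p \<in> X - B"
    obtain w \<kappa> where eq: "p = (w, \<kappa>)" by force
    from p eq have wk: "w permutes {0..<n}" "\<kappa> \<in> strip_chains M f n (jt_content \<mu> w)" "\<not> bad M n \<kappa>"
      by (auto simp: B_def X_def W_def)
    moreover from this have "w = id" using content_not_bad[OF \<mu>] unfolding n_def by blast
    ultimately show "p \<in> Pair (id :: nat \<Rightarrow> nat) ` ?G" using eq by blast
  next
    fix p assume "p \<in> Pair (id :: nat \<Rightarrow> nat) ` ?G"
    thus "p \<in> X - B" by (auto simp: B_def X_def W_def permutes_id)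
  qed
  also have "sum wt (Pair (id :: nat \<Rightarrow> nat) ` ?G) = (\<Sum>\<kappa>\<in>?G. jt M (\<kappa> n))"
    by (subst sum.reindex) (auto simp: inj_on_def wt_def sign_id)
  also have "jt_content \<mu> id = (\<lambda>i. int (\<mu> ! i))"
    by (simp add: jt_content_def fun_eq_iff)
  finally show ?thesis unfolding n_def .
qed

section \<open>Schur nonnegativity\<close>

lemma is_expansion_superset:
  assumes "finite A" "Poly_Mapping.keys c \<subseteq> A"
  shows "(\<Sum>\<mu>\<in>Poly_Mapping.keys c. Poly_Mapping.lookup c \<mu> *\<^sub>R b \<mu>) =
    (\<Sum>\<mu>\<in>A. Poly_Mapping.lookup c \<mu> *\<^sub>R (b \<mu> :: symfun))"
  by (rule sum.mono_neutral_left[OF assms]) (simp add: Poly_Mapping.in_keys_iff)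

lemma nonneg_wrt_0: "nonneg_wrt b 0"
  unfolding nonneg_wrt_def is_expansion_def by (rule exI[of _ 0]) simp

lemma nonneg_wrt_scaleR_basis:
  assumes "0 \<le> r" "\<mu> \<in> partitions"
  shows "nonneg_wrt b (r *\<^sub>R b \<mu>)"
  unfolding nonneg_wrt_def is_expansion_def
  by (rule exI[of _ "Poly_Mapping.single \<mu> r"])
    (use assms in \<open>auto simp: Poly_Mapping.lookup_single when_def\<close>)

lemma nonneg_wrt_add:
  assumes "nonneg_wrt b f" "nonneg_wrt b g"
  shows "nonneg_wrt b (f + g)"
proof -
  obtain c d where c: "is_expansion b c f" "\<forall>\<mu>\<in>partitions. 0 \<le> Poly_Mapping.lookup c \<mu>"
    and d: "is_expansion b d g" "\<forall>\<mu>\<in>partitions. 0 \<le> Poly_Mapping.lookup d \<mu>"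
    using assms by (auto simp: nonneg_wrt_def)
  let ?A = "Poly_Mapping.keys c \<union> Poly_Mapping.keys d"
  have sub: "Poly_Mapping.keys (c + d) \<subseteq> ?A" by (rule Poly_Mapping.keys_add)
  have "f + g = (\<Sum>\<mu>\<in>?A. Poly_Mapping.lookup c \<mu> *\<^sub>R b \<mu>) + (\<Sum>\<mu>\<in>?A. Poly_Mapping.lookup d \<mu> *\<^sub>R b \<mu>)"
    using c(1) d(1) by (simp add: is_expansion_def is_expansion_superset[of ?A])
  also have "\<dots> = (\<Sum>\<mu>\<in>?A. Poly_Mapping.lookup (c + d) \<mu> *\<^sub>R b \<mu>)"
    by (simp add: Poly_Mapping.lookup_add scaleR_add_left sum.distrib)
  finally have "is_expansion b (c + d) (f + g)"
    using c(1) d(1) sub is_expansion_superset[OF _ sub, of b] unfolding is_expansion_def by auto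
  thus ?thesis
    using c(2) d(2) unfolding nonneg_wrt_def by (auto intro!: exI[of _ "c + d"] simp: Poly_Mapping.lookup_add)
qed

lemma nonneg_wrt_sum: "(\<And>x. x \<in> A \<Longrightarrow> nonneg_wrt b (f x)) \<Longrightarrow> nonneg_wrt b (sum f A)"
  by (induction A rule: infinite_finite_induct) (simp_all add: nonneg_wrt_0 nonneg_wrt_add)

lemma nonneg_scaleR_jt:
  assumes "0 \<le> r" "antimono f" "\<And>i. M \<le> i \<Longrightarrow> f i = 0"
  shows "nonneg_wrt schur (r *\<^sub>R jt M f)"
  using jt_schur[OF assms(2,3)] nonneg_wrt_scaleR_basis[OF assms(1)] by metis

lemma nonneg_scaleR_schur_mult:
  assumes r: "0 \<le> r" and \<mu>: "\<mu> \<in> partitions" and \<nu>: "\<nu> \<in> partitions"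
  shows "nonneg_wrt schur (r *\<^sub>R (schur \<mu> * schur \<nu>))"
proof -
  define f where "f = (\<lambda>i. if i < length \<mu> then \<mu> ! i else 0)"
  define M where "M = length \<mu> + length \<nu>"
  have anti: "antimono f"
    unfolding antimono_iff_le_Suc f_def using \<mu> by (auto simp: partitions_def sorted_wrt_iff_nth_less)
  have zero: "f i = 0" if "length \<mu> \<le> i" for i using that by (simp add: f_def)
  have "jt (length \<mu>) f = schur \<mu>"
    unfolding schur_eq_jt by (rule jt_cong) (simp add: f_def)
  hence "schur \<mu> = jt M f"
    unfolding M_def by (subst jt_extend[OF zero]) auto
  hence "r *\<^sub>R (schur \<mu> * schur \<nu>) =
    (\<Sum>\<kappa> | \<kappa> \<in> strip_chains M f (length \<nu>) (\<lambda>i. int (\<nu> ! i)) \<and> \<not> bad M (length \<nu>) \<kappa>.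
      r *\<^sub>R jt M (\<kappa> (length \<nu>)))"
    using jt_mult_schur[where m = "length \<mu>" and M = M, OF \<nu> zero anti]
    by (simp add: M_def scaleR_sum_right)
  also have "nonneg_wrt schur \<dots>"
  proof (rule nonneg_wrt_sum, safe)
    fix \<kappa> assume \<kappa>: "\<kappa> \<in> strip_chains M f (length \<nu>) (\<lambda>i. int (\<nu> ! i))"
    show "nonneg_wrt schur (r *\<^sub>R jt M (\<kappa> (length \<nu>)))"
      by (rule nonneg_scaleR_jt[OF r strip_chains_antimono[OF \<kappa> anti]])
        (use strip_chains_zero[OF \<kappa> zero] in \<open>auto simp: M_def\<close>)
  qed
  finally show ?thesis .
qed

lemma nonneg_schur_mult:
  assumes "nonneg_wrt schur f" "nonneg_wrt schur g"
  shows "nonneg_wrt schur (f * g)"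
proof -
  obtain c d where c: "is_expansion schur c f" "\<forall>\<mu>\<in>partitions. 0 \<le> Poly_Mapping.lookup c \<mu>"
    and d: "is_expansion schur d g" "\<forall>\<mu>\<in>partitions. 0 \<le> Poly_Mapping.lookup d \<mu>"
    using assms by (auto simp: nonneg_wrt_def)
  have "f * g = (\<Sum>\<mu>\<in>Poly_Mapping.keys c. \<Sum>\<nu>\<in>Poly_Mapping.keys d.
      (Poly_Mapping.lookup c \<mu> * Poly_Mapping.lookup d \<nu>) *\<^sub>R (schur \<mu> * schur \<nu>))"
    using c(1) d(1) by (simp add: is_expansion_def sum_product mult.commute)
  also have "nonneg_wrt schur \<dots>"
    using c d by (intro nonneg_wrt_sum nonneg_scaleR_schur_mult) (auto simp: is_expansion_def subset_iff)
  finally show ?thesis .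
qed

section \<open>Rectangular Schur functions and Dodgson condensation\<close>

text \<open>With an integer argument, the zero that \<open>logconc\<close> uses to the left of index
  0 is the actual value \<open>rect n (-1)\<close>.\<close>

definition rect :: "nat \<Rightarrow> int \<Rightarrow> symfun" where
  "rect n k = det (mat n n (\<lambda>(i, j). H (k - int i + int j)))"

text \<open>The case k = -1 is included for the factor \<open>rect 3 (k - 1)\<close> of
  \<open>logconc_3\<close> at k = 0; there the last row of the matrix is zero.\<close>

lemma nonneg_rect:
  assumes "-1 \<le> k" "0 < n"
  shows "nonneg_wrt schur (rect n k)"
proof (cases "k = -1")
  case True
  hence "rect n k = 0"
    unfolding rect_def using assms(2) by (intro det_row_zero[of _ n "n - 1"]) auto
  thus ?thesis by (simp add: nonneg_wrt_0)
next
  case False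
  define f where "f = (\<lambda>i. if i < n then nat k else 0)"
  have "rect n k = 1 *\<^sub>R jt n f"
    unfolding rect_def jt_def scaleR_one using assms False
    by (intro arg_cong[where f = det] eq_matI) (auto simp: f_def)
  also have "nonneg_wrt schur \<dots>"
    by (rule nonneg_scaleR_jt) (auto simp: f_def antimono_iff_le_Suc)
  finally show ?thesis .
qed

lemma det_mat_Suc:
  fixes A :: "nat \<times> nat \<Rightarrow> 'a::comm_ring_1"
  shows "det (mat (Suc n) (Suc n) A) = (\<Sum>j<Suc n. (-1) ^ j * A (0, j) *
    det (mat n n (\<lambda>(i, j'). A (Suc i, if j' < j then j' else Suc j'))))"
  (is "det ?M = _")
proof -
  have "det ?M = (\<Sum>j<Suc n. ?M $$ (0, j) * cofactor ?M 0 j)"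
    by (rule laplace_expansion_row[of _ "Suc n"]) auto
  also have "\<dots> = (\<Sum>j<Suc n. (-1) ^ j * A (0, j) *
      det (mat n n (\<lambda>(i, j'). A (Suc i, if j' < j then j' else Suc j'))))"
  proof (rule sum.cong[OF refl])
    fix j assume j: "j \<in> {..<Suc n}"
    have "mat_delete ?M 0 j = mat n n (\<lambda>(i, j'). A (Suc i, if j' < j then j' else Suc j'))"
      using j by (intro eq_matI) (auto simp: mat_delete_def)
    thus "?M $$ (0, j) * cofactor ?M 0 j = (-1) ^ j * A (0, j) *
        det (mat n n (\<lambda>(i, j'). A (Suc i, if j' < j then j' else Suc j')))"
      using j by (simp add: cofactor_def mult_ac)
  qed
  finally show ?thesis .
qed

lemma det_mat_0: "det (mat 0 0 A) = 1"
  by (simp add: det_def)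

lemma rect_1: "rect 1 k = H k"
  unfolding rect_def by (subst det_single) auto

lemma rect_2: "rect 2 k = H k * H k - H (k - 1) * H (k + 1)"
  unfolding rect_def numeral_2_eq_2 by (simp add: det_mat_Suc det_mat_0 algebra_simps)

lemma rect_3: "rect 3 k = H k * (H k * H k - H (k - 1) * H (k + 1))
    - H (k + 1) * (H (k - 1) * H k - H (k - 2) * H (k + 1))
    + H (k + 2) * (H (k - 1) * H (k - 1) - H (k - 2) * H k)"
  unfolding rect_def numeral_3_eq_3 by (simp add: det_mat_Suc det_mat_0 algebra_simps)

lemma rect_4: "rect 4 k =
    H k * (H k * (H k * H k - H (k - 1) * H (k + 1))
      - H (k + 1) * (H (k - 1) * H k - H (k - 2) * H (k + 1))
      + H (k + 2) * (H (k - 1) * H (k - 1) - H (k - 2) * H k))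
    - H (k + 1) * (H (k - 1) * (H k * H k - H (k - 1) * H (k + 1))
      - H (k + 1) * (H (k - 2) * H k - H (k - 3) * H (k + 1))
      + H (k + 2) * (H (k - 2) * H (k - 1) - H (k - 3) * H k))
    + H (k + 2) * (H (k - 1) * (H (k - 1) * H k - H (k - 2) * H (k + 1))
      - H k * (H (k - 2) * H k - H (k - 3) * H (k + 1))
      + H (k + 2) * (H (k - 2) * H (k - 2) - H (k - 3) * H (k - 1)))
    - H (k + 3) * (H (k - 1) * (H (k - 1) * H (k - 1) - H (k - 2) * H k)
      - H k * (H (k - 2) * H (k - 1) - H (k - 3) * H k)
      + H (k + 1) * (H (k - 2) * H (k - 2) - H (k - 3) * H (k - 1)))"
proof -
  have 4: "(4::nat) = Suc (Suc (Suc (Suc 0)))" by simp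
  show ?thesis
    unfolding rect_def 4 by (simp add: det_mat_Suc det_mat_0 algebra_simps)
qed

lemma dodgson_2: "rect 2 k = rect 1 k * rect 1 k - rect 1 (k - 1) * rect 1 (k + 1)"
  by (simp add: rect_1[simplified] rect_2)

lemma dodgson_3: "rect 3 k * rect 1 k = rect 2 k * rect 2 k - rect 2 (k - 1) * rect 2 (k + 1)"
  unfolding rect_1 rect_2 rect_3 by (simp add: algebra_simps)

text \<open>Size 4 being the largest that occurs, condensation is checked as a polynomial identity
  in the seven entries \<open>H (k - 3)\<close> to \<open>H (k + 3)\<close>.\<close>

lemma dodgson_4: "rect 4 k * rect 2 k = rect 3 k * rect 3 k - rect 3 (k - 1) * rect 3 (k + 1)"
  unfolding rect_2 rect_3 rect_4 by (simp add: algebra_simps)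

section \<open>Iterates of the log-concavity operator in terms of rectangles\<close>

lemma logconc_int:
  assumes "F (-1) = (0 :: 'a::comm_ring_1)"
  shows "logconc (\<lambda>k. F (int k)) = (\<lambda>k. F (int k) * F (int k) - F (int k - 1) * F (int k + 1))"
proof
  fix k
  show "logconc (\<lambda>k. F (int k)) k = F (int k) * F (int k) - F (int k - 1) * F (int k + 1)"
    using assms by (cases k) (simp_all add: logconc_def power2_eq_square add.commute)
qed

lemma rect_neg: "0 < n \<Longrightarrow> rect n (-1) = 0"
  unfolding rect_def by (intro det_row_zero[of _ n "n - 1"]) auto

lemma complete_h_eq_rect: "complete_h = (\<lambda>k. rect 1 (int k))"
  by (simp add: fun_eq_iff rect_1[simplified] complete_h_int_def)

lemma logconc_1: "(logconc ^^ 1) complete_h = (\<lambda>k. rect 2 (int k))"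
  unfolding complete_h_eq_rect One_nat_def funpow.simps comp_id unfolding One_nat_def[symmetric] dodgson_2 by (rule logconc_int) (simp add: rect_neg)

lemma logconc_2: "(logconc ^^ 2) complete_h = (\<lambda>k. rect 3 (int k) * rect 1 (int k))"
proof -
  have "(logconc ^^ 2) complete_h = logconc ((logconc ^^ 1) complete_h)"
    by (simp add: numeral_2_eq_2)
  thus ?thesis
    by (simp only: logconc_1 logconc_int[of "rect 2"] rect_neg dodgson_3)
qed

text \<open>This is $AC - BD = (A - B) C + B (C - D)$ with $A = T_3(k)^2$, $B = T_3(k-1) T_3(k+1)$,
  $C = h_k^2$, $D = h_{k-1} h_{k+1}$, where condensation gives $A - B$ and $C - D$.\<close>

lemma logconc_3: "(logconc ^^ 3) complete_h = (\<lambda>k. let k = int k in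
    rect 4 k * rect 2 k * (rect 1 k * rect 1 k) + rect 3 (k - 1) * rect 3 (k + 1) * rect 2 k)"
proof -
  define F where "F k = rect 3 k * rect 1 k" for k
  have "(logconc ^^ 3) complete_h = logconc ((logconc ^^ 2) complete_h)"
    by (simp add: numeral_3_eq_3 numeral_2_eq_2)
  also have "\<dots> = (\<lambda>k. F (int k) * F (int k) - F (int k - 1) * F (int k + 1))"
    unfolding logconc_2 F_def[symmetric] by (rule logconc_int) (simp add: F_def rect_neg)
  also have "\<dots> = (\<lambda>k. let k = int k in
      rect 4 k * rect 2 k * (rect 1 k * rect 1 k) + rect 3 (k - 1) * rect 3 (k + 1) * rect 2 k)"
    unfolding Let_def dodgson_4 F_def unfolding dodgson_2 by (simp add: algebra_simps)
  finally show ?thesis .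
qed

lemma nonneg_logconc:
  assumes "i \<le> 3"
  shows "seq_nonneg_wrt schur ((logconc ^^ i) complete_h)"
proof -
  consider "i = 0" | "i = 1" | "i = 2" | "i = 3" using assms by linarith
  thus ?thesis
  proof cases
    case 1
    thus ?thesis by (simp add: seq_nonneg_wrt_def complete_h_eq_rect nonneg_rect)
  next
    case 2
    thus ?thesis
      unfolding seq_nonneg_wrt_def by (simp only: logconc_1) (simp add: nonneg_rect)
  next
    case 3
    thus ?thesis
      unfolding seq_nonneg_wrt_def by (simp only: logconc_2) (simp add: nonneg_rect nonneg_schur_mult)
  next
    case 4
    thus ?thesis
      unfolding seq_nonneg_wrt_def Let_def
      by (simp only: logconc_3 Let_def) (simp add: nonneg_rect nonneg_schur_mult nonneg_wrt_add)
  qed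
qed

section \<open>Restriction to four variables\<close>

lemma coeff_of_add: "coeff_of (f + g) \<alpha> = coeff_of f \<alpha> + coeff_of g \<alpha>"
  by transfer simp

lemma coeff_of_0 [simp]: "coeff_of 0 \<alpha> = 0"
  by transfer simp

lemma coeff_of_scaleR: "coeff_of (r *\<^sub>R f) \<alpha> = r * coeff_of f \<alpha>"
  by transfer simp

lemma coeff_of_diff: "coeff_of (f - g) \<alpha> = coeff_of f \<alpha> - coeff_of g \<alpha>"
  unfolding minus_symfun_def coeff_of_add by (simp add: uminus_symfun.rep_eq)

lemma coeff_of_mult: "coeff_of (f * g) \<alpha> = (\<Sum>(\<beta>, \<gamma>)\<in>mon_splits \<alpha>. coeff_of f \<beta> * coeff_of g \<gamma>)"
  by transfer simp

lemma coeff_of_sum: "coeff_of (sum f A) \<alpha> = (\<Sum>x\<in>A. coeff_of (f x) \<alpha>)"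
  by (induction A rule: infinite_finite_induct) (simp_all add: coeff_of_add)

lemma coeff_of_degree: "\<exists>d. \<forall>\<alpha>. coeff_of f \<alpha> \<noteq> 0 \<longrightarrow> mon_degree \<alpha> \<le> d"
  by transfer (simp add: symmetric_series_def)

lemma monomial_sf_nonneg: "0 \<le> coeff_of (monomial_sf \<mu>) \<alpha>"
  by transfer simp

lemma nonneg_monomial_coeff:
  assumes "nonneg_wrt monomial_sf f"
  shows "0 \<le> coeff_of f \<alpha>"
proof -
  obtain c where c: "is_expansion monomial_sf c f" "\<forall>\<mu>\<in>partitions. 0 \<le> Poly_Mapping.lookup c \<mu>"
    using assms by (auto simp: nonneg_wrt_def)
  have "coeff_of f \<alpha> = (\<Sum>\<mu>\<in>Poly_Mapping.keys c. Poly_Mapping.lookup c \<mu> * coeff_of (monomial_sf \<mu>) \<alpha>)"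
    using c(1) by (simp add: is_expansion_def coeff_of_sum coeff_of_scaleR)
  also have "\<dots> \<ge> 0"
    using c by (intro sum_nonneg mult_nonneg_nonneg monomial_sf_nonneg) (auto simp: is_expansion_def)
  finally show ?thesis .
qed

definition monomials4 :: "nat \<Rightarrow> monomial set" where
  "monomials4 d = {\<alpha>. Poly_Mapping.keys \<alpha> \<subseteq> {..<4} \<and> mon_degree \<alpha> \<le> d}"

lemma finite_monomials4: "finite (monomials4 d)"
proof -
  let ?F = "{f. \<forall>x. (x \<in> {..<4::nat} \<longrightarrow> f x \<in> {..d}) \<and> (x \<notin> {..<4} \<longrightarrow> f x = (0::nat))}"
  have "finite ?F" by (rule finite_set_of_finite_funs) auto
  moreover have "Poly_Mapping.lookup ` monomials4 d \<subseteq> ?F"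
  proof (rule image_subsetI)
    fix \<alpha> assume \<alpha>: "\<alpha> \<in> monomials4 d"
    hence "mon_degree \<alpha> = (\<Sum>i<4. Poly_Mapping.lookup \<alpha> i)"
      by (intro mon_degree_superset) (auto simp: monomials4_def)
    moreover have "Poly_Mapping.lookup \<alpha> x \<le> (\<Sum>i<4. Poly_Mapping.lookup \<alpha> i)" if "x < 4" for x
      by (rule member_le_sum) (use that in auto)
    ultimately have "Poly_Mapping.lookup \<alpha> x \<le> d" if "x < 4" for x
      using \<alpha> that by (fastforce simp: monomials4_def)
    moreover have "Poly_Mapping.lookup \<alpha> x = 0" if "\<not> x < 4" for x
      using \<alpha> that by (auto simp: monomials4_def subset_iff Poly_Mapping.in_keys_iff)
    ultimately show "Poly_Mapping.lookup \<alpha> \<in> ?F" by auto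
  qed
  ultimately have "finite (Poly_Mapping.lookup ` monomials4 d)"
    by (rule finite_subset[rotated])
  thus ?thesis
    by (rule finite_imageD) (auto simp: inj_on_def poly_mapping.lookup_inject)
qed

text \<open>The image of $r x_0^{\alpha_0} \cdots x_3^{\alpha_3}$ under $x_0 = x_1 = 1$, with $x_2$ the
  variable of the inner and $x_3$ that of the outer polynomial ring.\<close>

definition term4 :: "real \<Rightarrow> monomial \<Rightarrow> real poly poly" where
  "term4 r \<alpha> = monom (monom r (Poly_Mapping.lookup \<alpha> 2)) (Poly_Mapping.lookup \<alpha> 3)"

text \<open>Bounded degree in four variables makes the index set finite.\<close>

definition eval4 :: "symfun \<Rightarrow> real poly poly" where
  "eval4 f = (\<Sum>\<alpha> | Poly_Mapping.keys \<alpha> \<subseteq> {..<4} \<and> coeff_of f \<alpha> \<noteq> 0. term4 (coeff_of f \<alpha>) \<alpha>)"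

lemma term4_0 [simp]: "term4 0 \<alpha> = 0"
  by (simp add: term4_def)

lemma term4_diff: "term4 (r - s) \<alpha> = term4 r \<alpha> - term4 s \<alpha>"
  by (simp add: term4_def diff_monom[symmetric])

lemma term4_sum: "term4 (sum r A) \<alpha> = (\<Sum>x\<in>A. term4 (r x) \<alpha>)"
  by (simp add: term4_def monom_sum)

lemma term4_mult: "term4 (r * s) (\<alpha> + \<beta>) = term4 r \<alpha> * term4 s \<beta>"
  by (simp add: term4_def mult_monom Poly_Mapping.lookup_add)

lemma eval4_eq:
  assumes "\<And>\<alpha>. coeff_of f \<alpha> \<noteq> 0 \<Longrightarrow> mon_degree \<alpha> \<le> d"
  shows "eval4 f = (\<Sum>\<alpha>\<in>monomials4 d. term4 (coeff_of f \<alpha>) \<alpha>)"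
  unfolding eval4_def
  by (rule sum.mono_neutral_left[OF finite_monomials4]) (use assms in \<open>auto simp: monomials4_def\<close>)

lemma eval4_diff: "eval4 (f - g) = eval4 f - eval4 g"
proof -
  obtain d e where "\<And>\<alpha>. coeff_of f \<alpha> \<noteq> 0 \<Longrightarrow> mon_degree \<alpha> \<le> d"
    "\<And>\<alpha>. coeff_of g \<alpha> \<noteq> 0 \<Longrightarrow> mon_degree \<alpha> \<le> e"
    using coeff_of_degree by metis
  hence f: "coeff_of f \<alpha> \<noteq> 0 \<Longrightarrow> mon_degree \<alpha> \<le> max d e"
    and g: "coeff_of g \<alpha> \<noteq> 0 \<Longrightarrow> mon_degree \<alpha> \<le> max d e" for \<alpha>
    by (meson max.coboundedI1 max.coboundedI2)+
  have fg: "mon_degree \<alpha> \<le> max d e" if "coeff_of (f - g) \<alpha> \<noteq> 0" for \<alpha>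
    using that f[of \<alpha>] g[of \<alpha>] unfolding coeff_of_diff by (cases "coeff_of f \<alpha> = 0") auto
  have "eval4 f = (\<Sum>\<alpha>\<in>monomials4 (max d e). term4 (coeff_of f \<alpha>) \<alpha>)"
    "eval4 g = (\<Sum>\<alpha>\<in>monomials4 (max d e). term4 (coeff_of g \<alpha>) \<alpha>)"
    "eval4 (f - g) = (\<Sum>\<alpha>\<in>monomials4 (max d e). term4 (coeff_of (f - g) \<alpha>) \<alpha>)"
    using f g fg by (auto intro: eval4_eq)
  thus ?thesis
    by (simp only: coeff_of_diff term4_diff sum_subtractf)
qed

text \<open>Natural exponents cannot cancel, so factors of a monomial in x_0, ..., x_3 use only
  these variables. This makes \<open>eval4\<close> multiplicative.\<close>

lemma keys_add_nat:
  "Poly_Mapping.keys (\<alpha> + \<beta>) = Poly_Mapping.keys \<alpha> \<union> Poly_Mapping.keys (\<beta> :: monomial)"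
  by (auto simp: Poly_Mapping.in_keys_iff Poly_Mapping.lookup_add)

lemma eval4_mult: "eval4 (f * g) = eval4 f * eval4 g"
proof -
  obtain d where d: "\<And>\<alpha>. coeff_of f \<alpha> \<noteq> 0 \<Longrightarrow> mon_degree \<alpha> \<le> d" using coeff_of_degree by blast
  obtain e where e: "\<And>\<alpha>. coeff_of g \<alpha> \<noteq> 0 \<Longrightarrow> mon_degree \<alpha> \<le> e" using coeff_of_degree by blast
  have de: "mon_degree \<alpha> \<le> d + e" if nz: "coeff_of (f * g) \<alpha> \<noteq> 0" for \<alpha>
  proof -
    obtain p where "p \<in> mon_splits \<alpha>" "(case p of (\<beta>, \<gamma>) \<Rightarrow> coeff_of f \<beta> * coeff_of g \<gamma>) \<noteq> 0"
      by (rule sum.not_neutral_contains_not_neutral[OF nz[unfolded coeff_of_mult]])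
    thus ?thesis
      by (auto simp: mon_splits_def mon_degree_add intro!: add_mono d e)
  qed
  define T where "T = (\<lambda>(\<beta>, \<gamma>). term4 (coeff_of f \<beta>) \<beta> * term4 (coeff_of g \<gamma>) \<gamma>)"
  define X where "X = (SIGMA \<alpha>:monomials4 (d + e). mon_splits \<alpha>)"
  have finX: "finite X"
    unfolding X_def by (intro finite_SigmaI finite_monomials4 finite_mon_splits)
  have inj: "inj_on snd X"
    by (auto simp: inj_on_def X_def mon_splits_def)
  have "eval4 (f * g) = (\<Sum>\<alpha>\<in>monomials4 (d + e). term4 (coeff_of (f * g) \<alpha>) \<alpha>)"
    by (rule eval4_eq) (fact de)
  also have "\<dots> = (\<Sum>\<alpha>\<in>monomials4 (d + e). \<Sum>p\<in>mon_splits \<alpha>. T p)"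
    unfolding coeff_of_mult term4_sum T_def
    by (intro sum.cong refl) (auto simp: mon_splits_def term4_mult)
  also have "\<dots> = (\<Sum>p\<in>X. T (snd p))"
    unfolding X_def by (subst sum.Sigma) (auto simp: finite_monomials4 finite_mon_splits case_prod_unfold)
  also have "\<dots> = sum T (snd ` X)"
    by (subst sum.reindex[OF inj]) simp
  also have "\<dots> = sum T (monomials4 d \<times> monomials4 e)"
  proof (rule sum.mono_neutral_right)
    show "finite (snd ` X)" using finX by simp
    show "monomials4 d \<times> monomials4 e \<subseteq> snd ` X"
    proof clarify
      fix \<beta> \<gamma> assume "\<beta> \<in> monomials4 d" "\<gamma> \<in> monomials4 e"
      hence "(\<beta> + \<gamma>, (\<beta>, \<gamma>)) \<in> X"
        by (auto simp: X_def monomials4_def mon_splits_def keys_add_nat mon_degree_add)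
      thus "(\<beta>, \<gamma>) \<in> snd ` X" by force
    qed
    show "\<forall>p\<in>snd ` X - monomials4 d \<times> monomials4 e. T p = 0"
    proof
      fix p assume p: "p \<in> snd ` X - monomials4 d \<times> monomials4 e"
      obtain \<beta> \<gamma> where eq: "p = (\<beta>, \<gamma>)" by force
      with p have "Poly_Mapping.keys \<beta> \<subseteq> {..<4}" "Poly_Mapping.keys \<gamma> \<subseteq> {..<4}"
        by (auto simp: X_def monomials4_def mon_splits_def keys_add_nat)
      with p eq have "\<not> mon_degree \<beta> \<le> d \<or> \<not> mon_degree \<gamma> \<le> e"
        by (auto simp: monomials4_def)
      with d e have "coeff_of f \<beta> = 0 \<or> coeff_of g \<gamma> = 0" by blast
      thus "T p = 0" by (auto simp: T_def eq)
    qed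
  qed
  also have "\<dots> = (\<Sum>\<beta>\<in>monomials4 d. term4 (coeff_of f \<beta>) \<beta>) * (\<Sum>\<gamma>\<in>monomials4 e. term4 (coeff_of g \<gamma>) \<gamma>)"
    unfolding T_def sum_product sum.cartesian_product ..
  also have "\<dots> = eval4 f * eval4 g"
    using eval4_eq[of f d] eval4_eq[of g e] d e by simp
  finally show ?thesis .
qed

lemma coeff_term4: "coeff (coeff (term4 r \<alpha>) j) i =
    (if Poly_Mapping.lookup \<alpha> 2 = i \<and> Poly_Mapping.lookup \<alpha> 3 = j then r else 0)"
  by (simp add: term4_def)

lemma coeff_eval4_nonneg:
  assumes "nonneg_wrt monomial_sf f"
  shows "0 \<le> coeff (coeff (eval4 f) j) i"
  unfolding eval4_def coeff_sum coeff_term4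
  by (intro sum_nonneg) (simp add: nonneg_monomial_coeff[OF assms])

text \<open>The remaining degree k - i - j is shared between x_0 and x_1 in k - i - j + 1 ways;
  truncated subtraction gives 0 when i + j > k.\<close>

lemma coeff_eval4_complete_h:
  "coeff (coeff (eval4 (complete_h k)) j) i = real (Suc k - (i + j))"
proof -
  let ?l = "Poly_Mapping.lookup :: monomial \<Rightarrow> nat \<Rightarrow> nat"
  have deg: "mon_degree \<alpha> = ?l \<alpha> 0 + ?l \<alpha> 1 + ?l \<alpha> 2 + ?l \<alpha> 3" if "Poly_Mapping.keys \<alpha> \<subseteq> {..<4}" for \<alpha>
    using mon_degree_superset[OF _ that] by (simp add: numeral_eq_Suc)
  have nth_keys: "Poly_Mapping.keys (Poly_Mapping.nth [a, b, c, d]) \<subseteq> {..<4}" for a b c d :: nat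
    by (auto simp: Poly_Mapping.in_keys_iff nth_default_def split: if_splits simp del: keys_nth)
  have look: "?l (Poly_Mapping.nth [a, b, c, d]) 0 = a" "?l (Poly_Mapping.nth [a, b, c, d]) 1 = b"
    "?l (Poly_Mapping.nth [a, b, c, d]) 2 = c" "?l (Poly_Mapping.nth [a, b, c, d]) 3 = d" for a b c d
    by (simp_all add: nth_default_def)
  let ?A = "{\<alpha>. Poly_Mapping.keys \<alpha> \<subseteq> {..<4} \<and> mon_degree \<alpha> = k}"
  let ?B = "{\<alpha> \<in> ?A. ?l \<alpha> 2 = i \<and> ?l \<alpha> 3 = j}"
  have fin: "finite ?A"
    by (rule finite_subset[OF _ finite_monomials4[of k]]) (auto simp: monomials4_def)
  have "eval4 (complete_h k) = (\<Sum>\<alpha>\<in>?A. term4 1 \<alpha>)"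
    unfolding eval4_def complete_h.rep_eq by (intro sum.cong) auto
  hence "coeff (coeff (eval4 (complete_h k)) j) i = (\<Sum>\<alpha>\<in>?A. if ?l \<alpha> 2 = i \<and> ?l \<alpha> 3 = j then 1 else 0)"
    by (simp add: coeff_sum coeff_term4)
  also have "\<dots> = (\<Sum>\<alpha>\<in>?B. 1)"
    by (rule sum.inter_filter[OF fin, symmetric])
  also have "\<dots> = real (card ?B)" by simp
  also have "card ?B = card {a. a + i + j \<le> k}"
  proof (rule bij_betw_same_card[of "\<lambda>\<alpha>. ?l \<alpha> 0"],
      rule bij_betw_byWitness[where f' = "\<lambda>a. Poly_Mapping.nth [a, k - (a + i + j), i, j]"])
    show "\<forall>\<alpha>\<in>?B. Poly_Mapping.nth [?l \<alpha> 0, k - (?l \<alpha> 0 + i + j), i, j] = \<alpha>"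
    proof
      fix \<alpha> assume \<alpha>: "\<alpha> \<in> ?B"
      hence 1: "k - (?l \<alpha> 0 + i + j) = ?l \<alpha> 1" using deg[of \<alpha>] by auto
      have "?l (Poly_Mapping.nth [?l \<alpha> 0, ?l \<alpha> 1, i, j]) n = ?l \<alpha> n" for n
      proof -
        consider "n = 0" | "n = 1" | "n = 2" | "n = 3" | "\<not> n < 4" by linarith
        thus ?thesis
        proof cases
          case 5
          hence "?l \<alpha> n = 0" using \<alpha> by (auto simp: subset_iff Poly_Mapping.in_keys_iff)
          thus ?thesis using 5 by (simp add: nth_default_def)
        qed (use \<alpha> look in auto)
      qed
      thus "Poly_Mapping.nth [?l \<alpha> 0, k - (?l \<alpha> 0 + i + j), i, j] = \<alpha>"
        unfolding 1 by (rule poly_mapping_eqI)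
    qed
    show "\<forall>a\<in>{a. a + i + j \<le> k}. ?l (Poly_Mapping.nth [a, k - (a + i + j), i, j]) 0 = a"
      using look by blast
    show "(\<lambda>\<alpha>. ?l \<alpha> 0) ` ?B \<subseteq> {a. a + i + j \<le> k}"
      using deg by auto
    show "(\<lambda>a. Poly_Mapping.nth [a, k - (a + i + j), i, j]) ` {a. a + i + j \<le> k} \<subseteq> ?B"
    proof (rule image_subsetI)
      fix a assume "a \<in> {a. a + i + j \<le> k}"
      thus "Poly_Mapping.nth [a, k - (a + i + j), i, j] \<in> ?B"
        using nth_keys deg[OF nth_keys] look by (simp del: lookup_nth keys_nth)
    qed
  qed
  also have "{a. a + i + j \<le> k} = {..<Suc k - (i + j)}" by auto
  finally show ?thesis by simp
qed

section \<open>A negative coefficient\<close>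

text \<open>Computations are carried out modulo $x_3^2$.\<close>

definition jet :: "symfun \<Rightarrow> real poly \<times> real poly" where
  "jet f = (coeff (eval4 f) 0, coeff (eval4 f) 1)"

fun jet_step :: "real poly \<times> real poly \<Rightarrow> real poly \<times> real poly \<Rightarrow> real poly \<times> real poly \<Rightarrow> real poly \<times> real poly" where
  "jet_step (a, a') (b, b') (c, c') = (b * b - a * c, 2 * (b * b') - (a * c' + a' * c))"

fun jet_steps :: "(real poly \<times> real poly) list \<Rightarrow> (real poly \<times> real poly) list" where
  "jet_steps (x # y # z # xs) = jet_step x y z # jet_steps (y # z # xs)"
| "jet_steps _ = []"

definition jets :: "(nat \<Rightarrow> symfun) \<Rightarrow> nat \<Rightarrow> (real poly \<times> real poly) list" where
  "jets a n = map (\<lambda>k. jet (a k)) [0..<n]"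

lemma jet_0: "jet 0 = (0, 0)"
  using eval4_diff[of 0 0] by (simp add: jet_def)

lemma jet_logconc:
  "jet (logconc a k) = jet_step (jet (if k = 0 then 0 else a (k - 1))) (jet (a k)) (jet (a (Suc k)))"
proof -
  define f where "f = (if k = 0 then 0 else a (k - 1))"
  have c0: "coeff (p * q) 0 = coeff p 0 * coeff q 0"
    and c1: "coeff (p * q) 1 = coeff p 0 * coeff q 1 + coeff p 1 * coeff q 0" for p q :: "real poly poly"
    by (simp_all add: coeff_mult)
  have "logconc a k = a k * a k - f * a (Suc k)"
    by (simp add: logconc_def power2_eq_square f_def)
  hence "eval4 (logconc a k) = eval4 (a k) * eval4 (a k) - eval4 f * eval4 (a (Suc k))"
    by (simp only: eval4_diff eval4_mult)
  thus ?thesis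
    unfolding jet_def jet_step.simps f_def[symmetric]
    by (simp only: coeff_diff c0 c1) (simp add: mult.commute)
qed

lemma length_jet_steps: "length (jet_steps xs) = length xs - 2"
  by (induction xs rule: jet_steps.induct) auto

lemma nth_jet_steps:
  "Suc (Suc k) < length xs \<Longrightarrow> jet_steps xs ! k = jet_step (xs ! k) (xs ! Suc k) (xs ! Suc (Suc k))"
  by (induction xs arbitrary: k rule: jet_steps.induct) (auto simp: nth_Cons split: nat.split)

text \<open>The prepended pair is the value at index -1; on the right each application uses up one
  entry.\<close>

lemma jets_logconc: "jets (logconc a) n = jet_steps ((0, 0) # jets a (Suc n))"
proof (rule nth_equalityI)
  show "length (jets (logconc a) n) = length (jet_steps ((0, 0) # jets a (Suc n)))"
    by (simp add: jets_def length_jet_steps)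
  fix k assume "k < length (jets (logconc a) n)"
  thus "jets (logconc a) n ! k = jet_steps ((0, 0) # jets a (Suc n)) ! k"
    by (cases k) (simp_all add: nth_jet_steps jets_def jet_logconc jet_0 del: upt_Suc)
qed

lemma jet_complete_h:
  "jet (complete_h k) = (Poly (map (\<lambda>i. real (Suc k - i)) [0..<Suc k]), Poly (map (\<lambda>i. real (k - i)) [0..<k]))"
  by (auto simp: jet_def coeff_eval4_complete_h nth_default_def intro!: poly_eqI simp del: upt_Suc)

lemma jets_complete_h: "jets complete_h 7 =
   [([:1:], 0), ([:2, 1:], [:1:]), ([:3, 2, 1:], [:2, 1:]), ([:4, 3, 2, 1:], [:3, 2, 1:]),
    ([:5, 4, 3, 2, 1:], [:4, 3, 2, 1:]), ([:6, 5, 4, 3, 2, 1:], [:5, 4, 3, 2, 1:]),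
    ([:7, 6, 5, 4, 3, 2, 1:], [:6, 5, 4, 3, 2, 1:])]"
  by (simp add: jets_def jet_complete_h numeral_eq_Suc)

text \<open>The term is homogeneous of degree 2 * 2^4 = 32, so this number sums the coefficients of
  x_0^a x_1^b x_2^7 x_3 with a + b = 24.\<close>

lemma coeff_logconc_4: "coeff (coeff (eval4 ((logconc ^^ 4) complete_h 2)) 1) 7 = -3"
proof -
  \<comment> \<open>Three entries after four applications require 3 + 4 = 7 initial ones.\<close>
  have "jets ((logconc ^^ 4) complete_h) 3 =
      jet_steps ((0, 0) # jet_steps ((0, 0) # jet_steps ((0, 0) # jet_steps ((0, 0) # jets complete_h 7))))"
    by (simp add: jets_logconc numeral_eq_Suc)
  also have "jet_steps ((0, 0) # jets complete_h 7) =
     [([:1:], 0), ([:1, 2:], [:2, 1:]), ([:1, 2, 3:], [:2, 4, 2:]), ([:1, 2, 3, 4:], [:2, 4, 6, 3:]),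
      ([:1, 2, 3, 4, 5:], [:2, 4, 6, 8, 4:]), ([:1, 2, 3, 4, 5, 6:], [:2, 4, 6, 8, 10, 5:])]"
    by (simp add: jets_complete_h numeral_poly)
  also have "jet_steps ((0, 0) # \<dots>) =
     [([:1:], 0), ([:0, 2, 1:], [:2, 6, 2:]), ([:0, 0, 3, 2, 1:], [:0, 3, 10, 6, 2:]),
      ([:0, 0, 0, 4, 3, 2, 1:], [:0, 0, 4, 14, 10, 6, 2:]),
      ([:0, 0, 0, 0, 5, 4, 3, 2, 1:], [:0, 0, 0, 5, 18, 14, 10, 6, 2:])]"
    by (simp add: numeral_poly)
  finally have "jets ((logconc ^^ 4) complete_h) 3 ! 2 = ([:0, 0, 0, 0, 0, 0, 0, 0, 0, 0, 3, 2, 1:],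
      [:0, 0, 0, 0, 0, 0, 0, -3, -14, -15, -6, -25, -16, -8:])"
    by (simp add: numeral_poly)
  hence "coeff (eval4 ((logconc ^^ 4) complete_h 2)) 1 = [:0, 0, 0, 0, 0, 0, 0, -3, -14, -15, -6, -25, -16, -8:]"
    by (simp add: jets_def jet_def numeral_2_eq_2)
  thus ?thesis by (simp add: numeral_eq_Suc)
qed

lemma logconc_4_not_nonneg: "\<not> seq_nonneg_wrt monomial_sf ((logconc ^^ 4) complete_h)"
proof
  assume "seq_nonneg_wrt monomial_sf ((logconc ^^ 4) complete_h)"
  hence "nonneg_wrt monomial_sf ((logconc ^^ 4) complete_h 2)"
    by (simp add: seq_nonneg_wrt_def)
  from coeff_eval4_nonneg[OF this, of 1 7] coeff_logconc_4 show False by simp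
qed

theorem theorem6p4:
  shows "(\<forall>i\<le>3. seq_nonneg_wrt schur ((logconc ^^ i) complete_h)) \<and>
         \<not> seq_nonneg_wrt monomial_sf ((logconc ^^ 4) complete_h)"
  using nonneg_logconc logconc_4_not_nonneg by blast

end
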